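(* Let $\lambda/\mu$ be a skew shape, $\lambda=(\lambda_1,\ldots,\lambda_\ell)$, $\mu=(\mu_1,\ldots,\mu_\ell)$, and let $k\ge0$ be an integer. Then $$\mathbf S_{\lambda/\mu}(1,t,\ldots,t^k)=\sum_T \mathrm{wt}(T;q,t),$$ where the sum ranges over all reverse column-strict tableaux $T$ of shape $\lambda/\mu$ with entries in $\{0,1,\ldots,k\}$. Furthermore, for each such $T$, $$\lim_{t\to1}\mathrm{wt}(T;q,t)=q^{\sum_iT_i}\quad\text{and}\quad\lim_{q\to1}\mathrm{wt}(T;q,t^{\frac1{q-1}})=t^{\sum_iT_i},$$ where $\sum_i T_i$ is the sum of all entries of $T$.
   Context: Ring: $\hat{\mathbb Q}(\mathbf t)$ is the field of rational functions over $\mathbb Q$ in algebraically independent indeterminates denoted $t^{q^r}$, $r\in\mathbb Z$ ($t=t^{q^0}$; $q$ is a formal symbol). For $f(q)=\sum_rc_rq^r\in\mathbb Z[q,q^{-1}]$ write $t^{f(q)}:=\prod_r(t^{q^r})^{c_r}$. The Frobenius automorphism $\varphi$ sends $t^{q^r}\mapsto t^{q^{r+1}}$. For $u=t^{q^a-q^b}$ put $[q]_u:=\frac{1-\varphi(u)}{1-u}$ (which is $1+u+\cdots+u^{q-1}$ when $q$ is a positive integer). Skew Schur analogue: in $N$ variables, for a partition $\nu=(\nu_1\ge\cdots\ge\nu_N\ge0)$, $\mathbf S_\nu(1,t,\ldots,t^{N-1}):=\det\big((t^{q^{\nu_j+N-j}})^{i-1}\big)_{i,j=1}^N\big/\det\big((t^{q^{N-j}})^{i-1}\big)_{i,j=1}^N$.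 Let $\mathbf H_r:=\mathbf S_{(r,0,\ldots,0)}$ for $r\ge0$, and $\mathbf H_r:=0$ for $r<0$. A skew shape $\lambda/\mu$ is given by partitions $\lambda=(\lambda_1,\ldots,\lambda_\ell)$, $\mu=(\mu_1,\ldots,\mu_\ell)$ (zero parts allowed) with $\mu_i\le\lambda_i$ for all $i$, and $$\mathbf S_{\lambda/\mu}(1,t,\ldots,t^k):=\det\left(\varphi^{\mu_j-(j-1)}\,\mathbf H_{\lambda_i-\mu_j-i+j}(1,t,\ldots,t^k)\right)_{i,j=1}^{\ell}.$$ Tableaux: a reverse column-strict tableau of shape $\lambda/\mu$ assigns an entry to each cell so that entries decrease weakly left-to-right in rows and decrease strictly top-to-bottom in columns. Weights: for a partition $\nu$ with at most $k$ nonzero parts and a cell $x$ in row $i$, column $j$ of its Ferrers diagram (English notation), put $\mathrm d(x)=j-i+k-1$ and $e_k(x)=q^{i+\mathrm d(x)}-q^{\mathrm d(x)}$; let $\mathrm{wt}(x,\nu,k;q,t)=t^{e_k(x)}[q]_{t^{e_k(x)}}$ if $x$ is the bottom cell of $\nu$ in its column, and $[q]_{t^{e_k(x)}}$ otherwise; $\mathrm{wt}(\nu,k;q,t):=\prod_{x\in\nu}\mathrm{wt}(x,\nu,k;q,t)$. For a reverse column-strict tableau $T$ of shape $\lambda/\mu$ with entries in $\{0,\ldots,k\}$, let $\nu^{(i)}$ be the partition whose successive column lengths are the entries of row $i$ of $T$ read left to right (so $\nu^{(i)}$ has at most $k$ parts, each at most $\lambda_i-\mu_i$). Then $$\mathrm{wt}(T;q,t):=\prod_{i=1}^\ell\varphi^{\mu_i-(i-1)}\,\mathrm{wt}(\nu^{(i)},k;q,t).$$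 Limits: $\lim_{t\to1}F(q,t)$ means: fix an integer $q\ge2$, interpret each $t^{q^r}$ as the actual $q^r$-th power of $t$ (in $\bigcup_{r\ge0}\mathbb Q(t^{q^{-r}})$), and then set $t$ and all its fractional powers equal to $1$. $\lim_{q\to1}F(q,t^{1/(q-1)})$ means the image of $F$ under the homomorphism sending $t^{q^r-q^s}=t^{q^r}/t^{q^s}\mapsto t^{r-s}\in\mathbb Q(t)$. *)

theory Defs
  imports
    Complex_Main
    "HOL-Library.FuncSet"
    "HOL-Library.Poly_Mapping"
    "HOL-Computational_Algebra.Polynomial"
    "HOL-Computational_Algebra.Fraction_Field"
    "Jordan_Normal_Form.Determinant"
begin

section \<open>Linear extension from monomials\<close>

definition lin_ext :: "('a \<Rightarrow> 'c::zero \<Rightarrow> 'b::comm_monoid_add) \<Rightarrow> ('a \<Rightarrow>\<^sub>0 'c) \<Rightarrow> 'b" where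
  "lin_ext h p = (\<Sum>a\<in>Poly_Mapping.keys p. h a (Poly_Mapping.lookup p a))"

lemma lin_ext_zero [simp]: "lin_ext h 0 = 0"
  by (simp add: lin_ext_def)

lemma lin_ext_superset:
  assumes "finite S" "Poly_Mapping.keys p \<subseteq> S" "\<And>a. h a 0 = 0"
  shows "lin_ext h p = (\<Sum>a\<in>S. h a (Poly_Mapping.lookup p a))"
  unfolding lin_ext_def
  by (rule sum.mono_neutral_left) (use assms in \<open>auto simp: in_keys_iff\<close>)

lemma lin_ext_single:
  assumes "h a 0 = 0"
  shows "lin_ext h (Poly_Mapping.single a c) = h a c"
  using assms by (simp add: lin_ext_def)

lemma lin_ext_add:
  fixes p q :: "'a \<Rightarrow>\<^sub>0 'c::comm_monoid_add"
  assumes "\<And>a. h a 0 = 0" "\<And>a c d. h a (c + d) = h a c + h a d"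
  shows "lin_ext h (p + q) = lin_ext h p + lin_ext h q"
proof -
  let ?S = "Poly_Mapping.keys p \<union> Poly_Mapping.keys q"
  have "lin_ext h (p + q) = (\<Sum>a\<in>?S. h a (Poly_Mapping.lookup (p + q) a))"
    by (rule lin_ext_superset) (use assms Poly_Mapping.keys_add[of p q] in auto)
  moreover have "lin_ext h p = (\<Sum>a\<in>?S. h a (Poly_Mapping.lookup p a))"
    by (rule lin_ext_superset) (use assms in auto)
  moreover have "lin_ext h q = (\<Sum>a\<in>?S. h a (Poly_Mapping.lookup q a))"
    by (rule lin_ext_superset) (use assms in auto)
  ultimately show ?thesis
    by (simp add: lookup_add assms sum.distrib)
qed

lemma single_add_induct [case_names zero add]:
  fixes p :: "'a \<Rightarrow>\<^sub>0 'c::comm_monoid_add"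
  assumes "P 0" "\<And>a c p. P p \<Longrightarrow> P (Poly_Mapping.single a c + p)"
  shows "P p"
proof (induction p rule: Poly_Mapping.update_induct)
  case (update p a c)
  have "Poly_Mapping.update a c p = Poly_Mapping.single a c + p"
    using update(1)
    by (intro poly_mapping_eqI) (auto simp: lookup_add lookup_update lookup_single in_keys_iff when_def)
  then show ?case using assms(2) update by simp
qed (rule assms(1))

lemma lin_ext_mult:
  fixes p q :: "'a::monoid_add \<Rightarrow>\<^sub>0 'c::comm_semiring_0" and h :: "'a \<Rightarrow> 'c \<Rightarrow> 'b::comm_semiring_0"
  assumes z: "\<And>a. h a 0 = 0" and s: "\<And>a c d. h a (c + d) = h a c + h a d"
    and m: "\<And>a b c d. h (a + b) (c * d) = h a c * h b d"
  shows "lin_ext h (p * q) = lin_ext h p * lin_ext h q"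
proof (induction p rule: single_add_induct)
  case (add a c p)
  have "lin_ext h (Poly_Mapping.single a c * q) = h a c * lin_ext h q"
  proof (induction q rule: single_add_induct)
    case (add b d q)
    then show ?case
      by (simp add: distrib_left Poly_Mapping.mult_single lin_ext_add lin_ext_single z s m)
  qed simp
  then show ?case using add by (simp add: distrib_right lin_ext_add lin_ext_single z s)
qed simp

text \<open>The linear map sending the monomial with exponent \<open>a\<close> to the one with exponent \<open>g a\<close>.\<close>

definition mon_map :: "('a \<Rightarrow> 'b) \<Rightarrow> ('a \<Rightarrow>\<^sub>0 rat) \<Rightarrow> ('b \<Rightarrow>\<^sub>0 rat)" where
  "mon_map g = lin_ext (\<lambda>a c. Poly_Mapping.single (g a) c)"

lemma mon_map_single [simp]:
  "mon_map g (Poly_Mapping.single a c) = Poly_Mapping.single (g a) c"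
  by (simp add: mon_map_def lin_ext_single)

lemma mon_map_zero [simp]: "mon_map g 0 = 0"
  by (simp add: mon_map_def)

lemma mon_map_add: "mon_map g (p + q) = mon_map g p + mon_map g q"
  unfolding mon_map_def by (rule lin_ext_add) (auto simp: Poly_Mapping.single_add)

lemma mon_map_mult:
  fixes g :: "'a::comm_monoid_add \<Rightarrow> 'b::comm_monoid_add"
  assumes "\<And>a b. g (a + b) = g a + g b"
  shows "mon_map g (p * q) = mon_map g p * mon_map g q"
  unfolding mon_map_def
  by (rule lin_ext_mult) (auto simp: Poly_Mapping.single_add Poly_Mapping.mult_single assms)

lemma mon_map_comp_id:
  assumes "\<And>a. g (h a) = a"
  shows "mon_map g (mon_map h p) = p"
  by (induction p rule: single_add_induct) (simp_all add: mon_map_add assms)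


section \<open>The field of rational functions in the indeterminates \<open>t\<^bsup>q^r\<^esup>\<close>\<close>

text \<open>
  An exponent \<open>f(q) = \<Sum>r. c\<^sub>r q\<^sup>r\<close> is the finitely supported map \<open>r \<mapsto> c\<^sub>r\<close>; the convolution
  product of \<open>Poly_Mapping\<close> is then the product of \<open>\<int>[q,q\<^sup>-\<^sup>1]\<close>. The Laurent monomials in the
  indeterminates \<open>t\<^bsup>q^r\<^esup>\<close> are exactly the \<open>t\<^bsup>f(q)\<^esup>\<close>, so Laurent polynomials are finitely
  supported functions on exponents. Their field of fractions is also that of the polynomial
  ring in the \<open>t\<^bsup>q^r\<^esup>\<close>.
\<close>

type_synonym q_exp = "int \<Rightarrow>\<^sub>0 int"
type_synonym t_laurent = "q_exp \<Rightarrow>\<^sub>0 rat"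
type_synonym t_field = "t_laurent fract"

definition q_pow :: "int \<Rightarrow> q_exp" where
  "q_pow r = Poly_Mapping.single r 1"

definition t_pow :: "q_exp \<Rightarrow> t_field" where
  "t_pow f = Fract (Poly_Mapping.single f 1) 1"

lemma t_pow_zero: "t_pow 0 = 1"
  by (simp add: t_pow_def One_fract_def)

lemma t_pow_add: "t_pow (f + g) = t_pow f * t_pow g"
  by (simp add: t_pow_def Poly_Mapping.mult_single)

definition frob_laurent :: "t_laurent \<Rightarrow> t_laurent" where
  "frob_laurent = mon_map (\<lambda>f. q_pow 1 * f)"

lemma frob_laurent_mult: "frob_laurent (a * b) = frob_laurent a * frob_laurent b"
  unfolding frob_laurent_def by (rule mon_map_mult) (simp add: distrib_left)

lemma q_pow_inverse: "q_pow (- 1) * (q_pow 1 * f) = f" "q_pow 1 * (q_pow (- 1) * f) = f"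
proof -
  have "q_pow (- 1) * q_pow 1 = 1" "q_pow 1 * q_pow (- 1) = 1"
    by (simp_all add: q_pow_def Poly_Mapping.mult_single)
  then show "q_pow (- 1) * (q_pow 1 * f) = f" "q_pow 1 * (q_pow (- 1) * f) = f"
    by (metis mult.assoc mult_1)+
qed

lemma frob_laurent_eq_0_iff: "frob_laurent p = 0 \<longleftrightarrow> p = 0"
  by (metis frob_laurent_def mon_map_comp_id mon_map_zero q_pow_inverse(1))

definition frob :: "t_field \<Rightarrow> t_field" where
  "frob x = (THE y. \<forall>a b. b \<noteq> 0 \<longrightarrow> x = Fract a b \<longrightarrow> y = Fract (frob_laurent a) (frob_laurent b))"

lemma frob_Fract:
  assumes "b \<noteq> 0"
  shows "frob (Fract a b) = Fract (frob_laurent a) (frob_laurent b)"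
  unfolding frob_def
proof (rule the_equality)
  show "\<forall>a' b'. b' \<noteq> 0 \<longrightarrow> Fract a b = Fract a' b' \<longrightarrow>
      Fract (frob_laurent a) (frob_laurent b) = Fract (frob_laurent a') (frob_laurent b')"
    using assms by (auto simp: eq_fract frob_laurent_eq_0_iff simp flip: frob_laurent_mult)
qed (use assms in blast)

lemma frob_t_pow: "frob (t_pow (q_pow r)) = t_pow (q_pow (r + 1))"
proof -
  have "q_pow 1 * q_pow r = q_pow (r + 1)"
    by (simp add: q_pow_def Poly_Mapping.mult_single add.commute)
  moreover have "frob_laurent 1 = 1"
    unfolding frob_laurent_def by (metis mon_map_single mult_zero_right single_one)
  ultimately show ?thesis
    by (simp add: t_pow_def frob_Fract) (simp add: frob_laurent_def)
qed

lemma bij_frob: "bij frob"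
proof (rule bijI)
  show "surj frob"
  proof (rule surjI)
    let ?g = "mon_map (\<lambda>f. q_pow (- 1) * f) :: t_laurent \<Rightarrow> t_laurent"
    have 1: "frob_laurent (?g p) = p" for p
      unfolding frob_laurent_def by (rule mon_map_comp_id) (rule q_pow_inverse)
    fix x :: t_field
    show "frob ((\<lambda>x. SOME y. frob y = x) x) = x"
    proof (cases x)
      case (Fract a b)
      have "?g b \<noteq> 0" using 1[of b] Fract(2) by (metis frob_laurent_eq_0_iff)
      then have "frob (Fract (?g a) (?g b)) = x"
        by (simp add: frob_Fract 1 Fract(1))
      then show ?thesis by (metis (mono_tags, lifting) someI)
    qed
  qed
  show "inj frob"
  proof (rule injI)
    fix x y assume eq: "frob x = frob y"
    show "x = y"
    proof (cases x, cases y)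
      fix a b c d assume *: "x = Fract a b" "b \<noteq> 0" "y = Fract c d" "d \<noteq> 0"
      then have "frob_laurent (a * d) = frob_laurent (c * b)"
        using eq by (simp add: frob_Fract eq_fract frob_laurent_eq_0_iff frob_laurent_mult)
      then have "a * d = c * b"
        by (metis frob_laurent_def mon_map_comp_id q_pow_inverse(1))
      then show ?thesis using * by (simp add: eq_fract)
    qed
  qed
qed

definition frob_pow :: "int \<Rightarrow> t_field \<Rightarrow> t_field" where
  "frob_pow m = (if 0 \<le> m then frob ^^ nat m else inv_into UNIV frob ^^ nat (- m))"

definition q_bracket :: "t_field \<Rightarrow> t_field" where
  "q_bracket u = (1 - frob u) / (1 - u)"


section \<open>The analogue of skew Schur functions\<close>

text \<open>
  Partitions are weakly decreasing lists, zero parts allowed. List and matrix indices start at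
  \<open>0\<close>, so \<open>i\<close> and \<open>j\<close> in the determinants below are one less than usual.
\<close>

definition schur :: "nat \<Rightarrow> nat list \<Rightarrow> t_field" where
  "schur N nu =
     det (mat N N (\<lambda>(i, j). t_pow (q_pow (int (nu ! j) + int N - 1 - int j)) ^ i)) /
     det (mat N N (\<lambda>(i, j). t_pow (q_pow (int N - 1 - int j)) ^ i))"

text \<open>\<open>complete k r\<close> is \<open>H\<^sub>r(1,t,\<dots>,t\<^sup>k)\<close>, in \<open>N = k + 1\<close> variables.\<close>

definition complete :: "nat \<Rightarrow> int \<Rightarrow> t_field" where
  "complete k r = (if r < 0 then 0 else schur (k + 1) (nat r # replicate k 0))"

definition skew_shape :: "nat list \<Rightarrow> nat list \<Rightarrow> bool" where
  "skew_shape lam mu \<longleftrightarrow> length mu = length lam \<and> sorted_wrt (\<ge>) lam \<and> sorted_wrt (\<ge>) mu \<and>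
     (\<forall>i < length lam. mu ! i \<le> lam ! i)"

definition skew_schur :: "nat \<Rightarrow> nat list \<Rightarrow> nat list \<Rightarrow> t_field" where
  "skew_schur k lam mu =
     det (mat (length lam) (length lam) (\<lambda>(i, j).
       frob_pow (int (mu ! j) - int j)
         (complete k (int (lam ! i) - int (mu ! j) - int i + int j))))"


section \<open>Tableaux and their weights\<close>

definition skew_cells :: "nat list \<Rightarrow> nat list \<Rightarrow> (nat \<times> nat) set" where
  "skew_cells lam mu = {(i, j). i < length lam \<and> mu ! i \<le> j \<and> j < lam ! i}"

text \<open>Tableaux are extensional functions, so that each tableau is counted once.\<close>

definition tableaux :: "nat \<Rightarrow> nat list \<Rightarrow> nat list \<Rightarrow> (nat \<times> nat \<Rightarrow> nat) set" where
  "tableaux k lam mu = {T \<in> skew_cells lam mu \<rightarrow>\<^sub>E {0..k}.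
     (\<forall>i j j'. (i, j) \<in> skew_cells lam mu \<longrightarrow> (i, j') \<in> skew_cells lam mu \<longrightarrow> j < j' \<longrightarrow>
        T (i, j) \<ge> T (i, j')) \<and>
     (\<forall>i i' j. (i, j) \<in> skew_cells lam mu \<longrightarrow> (i', j) \<in> skew_cells lam mu \<longrightarrow> i < i' \<longrightarrow>
        T (i, j) > T (i', j))}"

definition entry_sum :: "nat list \<Rightarrow> nat list \<Rightarrow> (nat \<times> nat \<Rightarrow> nat) \<Rightarrow> nat" where
  "entry_sum lam mu T = (\<Sum>x \<in> skew_cells lam mu. T x)"

text \<open>Here rows and columns are numbered from \<open>1\<close>, as in the weights.\<close>

definition ferrers :: "nat list \<Rightarrow> (nat \<times> nat) set" where
  "ferrers nu = {(i, j). 1 \<le> i \<and> i \<le> length nu \<and> 1 \<le> j \<and> j \<le> nu ! (i - 1)}"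

definition depth :: "nat \<Rightarrow> nat \<times> nat \<Rightarrow> int" where
  "depth k x = int (snd x) - int (fst x) + int k - 1"

definition cell_exp :: "nat \<Rightarrow> nat \<times> nat \<Rightarrow> q_exp" where
  "cell_exp k x = q_pow (int (fst x) + depth k x) - q_pow (depth k x)"

definition cell_wt :: "nat \<Rightarrow> nat list \<Rightarrow> nat \<times> nat \<Rightarrow> t_field" where
  "cell_wt k nu x =
     (if (Suc (fst x), snd x) \<notin> ferrers nu
      then t_pow (cell_exp k x) * q_bracket (t_pow (cell_exp k x))
      else q_bracket (t_pow (cell_exp k x)))"

definition partition_wt :: "nat \<Rightarrow> nat list \<Rightarrow> t_field" where
  "partition_wt k nu = (\<Prod>x \<in> ferrers nu. cell_wt k nu x)"

text \<open>The partition with given column lengths.\<close>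

definition of_columns :: "nat list \<Rightarrow> nat list" where
  "of_columns cs = map (\<lambda>i. length (filter (\<lambda>c. i \<le> c) cs)) [1..<Suc (foldr max cs 0)]"

lemma ferrers_of_columns:
  assumes "sorted_wrt (\<ge>) cs"
  shows "(i, j) \<in> ferrers (of_columns cs) \<longleftrightarrow> 1 \<le> j \<and> j \<le> length cs \<and> 1 \<le> i \<and> i \<le> cs ! (j - 1)"
proof -
  have *: "j \<le> length (filter (\<lambda>c. i \<le> c) cs) \<longleftrightarrow> j \<le> length cs \<and> i \<le> cs ! (j - 1)"
    if "1 \<le> j" for j using assms that
  proof (induction cs arbitrary: j)
    case (Cons c cs)
    show ?case
    proof (cases "i \<le> c")
      case True
      show ?thesis
      proof (cases "j = 1")
        case False
        then obtain l where "j = Suc l" "1 \<le> l"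
          using Cons.prems(2) by (cases j) auto
        then show ?thesis using Cons True by (cases l) auto
      qed (use True in auto)
    next
      case False
      then have e: "filter (\<lambda>c. i \<le> c) (c # cs) = []"
        using Cons.prems(1) by (auto simp: filter_empty_conv)
      have "\<not> i \<le> (c # cs) ! (j - 1)" if "j \<le> length (c # cs)"
      proof -
        have "(c # cs) ! (j - 1) \<in> set (c # cs)"
          using that Cons.prems(2) by (intro nth_mem) auto
        then show ?thesis using e unfolding filter_empty_conv by blast
      qed
      then show ?thesis using e Cons.prems(2) by auto
    qed
  qed auto
  have "c \<le> foldr max cs 0" if "c \<in> set cs" for c
    using that by (induction cs) auto
  then have "i \<le> foldr max cs 0" if "1 \<le> j" "j \<le> length cs" "i \<le> cs ! (j - 1)"
    using that nth_mem[of "j - 1" cs] by fastforce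
  then show ?thesis
    using * by (auto simp: ferrers_def of_columns_def nth_append simp del: upt_Suc)
qed

definition row_partition :: "nat list \<Rightarrow> nat list \<Rightarrow> (nat \<times> nat \<Rightarrow> nat) \<Rightarrow> nat \<Rightarrow> nat list" where
  "row_partition lam mu T i = of_columns (map (\<lambda>j. T (i, j)) [mu ! i..<lam ! i])"

definition tableau_wt :: "nat \<Rightarrow> nat list \<Rightarrow> nat list \<Rightarrow> (nat \<times> nat \<Rightarrow> nat) \<Rightarrow> t_field" where
  "tableau_wt k lam mu T =
     (\<Prod>i < length lam. frob_pow (int (mu ! i) - int i) (partition_wt k (row_partition lam mu T i)))"


section \<open>The limit \<open>t \<rightarrow> 1\<close>\<close>

text \<open>
  For an integer \<open>q\<close> the actual powers of \<open>t\<close> live in the field of fractions of \<open>\<rat>[t\<^sup>a | a \<in> \<rat>]\<close>,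
  which contains \<open>\<rat>(t\<^bsup>q^-r\<^esup>)\<close> for all \<open>r\<close>. Both steps of the limit are only partially defined
  (a denominator may vanish), hence relations; each is single-valued.
\<close>

definition exp_eval :: "rat \<Rightarrow> q_exp \<Rightarrow> rat" where
  "exp_eval x f = lin_ext (\<lambda>r c. of_int c * x powi r) f"

definition actual_powers :: "nat \<Rightarrow> t_laurent \<Rightarrow> (rat \<Rightarrow>\<^sub>0 rat)" where
  "actual_powers q = mon_map (exp_eval (of_nat q))"

definition interpreted_as :: "nat \<Rightarrow> t_field \<Rightarrow> (rat \<Rightarrow>\<^sub>0 rat) fract \<Rightarrow> bool" where
  "interpreted_as q F G \<longleftrightarrow>
     (\<exists>a b. F = Fract a b \<and> actual_powers q b \<noteq> 0 \<and> G = Fract (actual_powers q a) (actual_powers q b))"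

definition at_one :: "(rat \<Rightarrow>\<^sub>0 rat) \<Rightarrow> rat" where
  "at_one p = lin_ext (\<lambda>a c. c) p"

definition value_at_one :: "(rat \<Rightarrow>\<^sub>0 rat) fract \<Rightarrow> rat \<Rightarrow> bool" where
  "value_at_one G c \<longleftrightarrow> (\<exists>a b. G = Fract a b \<and> at_one b \<noteq> 0 \<and> c = at_one a / at_one b)"

definition has_limit_t_1 :: "nat \<Rightarrow> t_field \<Rightarrow> rat \<Rightarrow> bool" where
  "has_limit_t_1 q F c \<longleftrightarrow> (\<exists>G. interpreted_as q F G \<and> value_at_one G c)"

lemma exp_eval_add: "exp_eval x (f + g) = exp_eval x f + exp_eval x g"
  unfolding exp_eval_def by (rule lin_ext_add) (auto simp: distrib_right)

lemma actual_powers_mult: "actual_powers q (a * b) = actual_powers q a * actual_powers q b"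
  unfolding actual_powers_def by (rule mon_map_mult) (rule exp_eval_add)

lemma at_one_mult: "at_one (a * b) = at_one a * at_one b"
  unfolding at_one_def by (rule lin_ext_mult) auto

lemma interpreted_as_unique:
  assumes "interpreted_as q F G" "interpreted_as q F G'"
  shows "G = G'"
proof -
  obtain a b a' b' where F: "F = Fract a b" "F = Fract a' b'"
    and nz: "actual_powers q b \<noteq> 0" "actual_powers q b' \<noteq> 0"
    and G: "G = Fract (actual_powers q a) (actual_powers q b)"
      "G' = Fract (actual_powers q a') (actual_powers q b')"
    using assms unfolding interpreted_as_def by blast
  have "b \<noteq> 0" "b' \<noteq> 0" using nz by (auto simp: actual_powers_def)
  then have "a * b' = a' * b" using F by (simp add: eq_fract)
  then show ?thesis using nz G by (simp add: eq_fract flip: actual_powers_mult)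
qed

lemma value_at_one_unique:
  assumes "value_at_one G c" "value_at_one G c'"
  shows "c = c'"
proof -
  obtain a b a' b' where G: "G = Fract a b" "G = Fract a' b'"
    and nz: "at_one b \<noteq> 0" "at_one b' \<noteq> 0"
    and c: "c = at_one a / at_one b" "c' = at_one a' / at_one b'"
    using assms unfolding value_at_one_def by blast
  have "b \<noteq> 0" "b' \<noteq> 0" using nz by (auto simp: at_one_def)
  then have "a * b' = a' * b" using G by (simp add: eq_fract)
  then show ?thesis using nz c by (simp add: frac_eq_eq flip: at_one_mult)
qed

lemma has_limit_t_1_unique: "has_limit_t_1 q F c \<Longrightarrow> has_limit_t_1 q F c' \<Longrightarrow> c = c'"
  unfolding has_limit_t_1_def using interpreted_as_unique value_at_one_unique by blast


section \<open>The limit \<open>q \<rightarrow> 1\<close> after \<open>t \<mapsto> t\<^bsup>1/(q-1)\<^esup>\<close>\<close>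

type_synonym rat_fun = "rat poly fract"

definition t_var :: rat_fun where
  "t_var = Fract [:0, 1:] 1"

text \<open>The \<open>\<rat>\<close>-algebra generated by the \<open>t\<^bsup>q^r - q^s\<^esup>\<close>, on which the limit is a homomorphism.\<close>

inductive_set diff_alg :: "t_laurent set" where
  const: "Poly_Mapping.single 0 c \<in> diff_alg"
| gen: "Poly_Mapping.single (q_pow r - q_pow s) 1 \<in> diff_alg"
| add: "a \<in> diff_alg \<Longrightarrow> b \<in> diff_alg \<Longrightarrow> a + b \<in> diff_alg"
| mult: "a \<in> diff_alg \<Longrightarrow> b \<in> diff_alg \<Longrightarrow> a * b \<in> diff_alg"

text \<open>
  The homomorphism with \<open>t\<^bsup>q^r\<^esup> \<mapsto> t\<^sup>r\<close>, i.e.\ \<open>t\<^bsup>f(q)\<^esup> \<mapsto> t\<^bsup>f'(1)\<^esup>\<close>. It is used on \<open>diff_alg\<close> only,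
  where it is the unique one with \<open>t\<^bsup>q^r - q^s\<^esup> \<mapsto> t\<^bsup>r - s\<^esup>\<close>.
\<close>

definition exp_deriv :: "q_exp \<Rightarrow> int" where
  "exp_deriv f = lin_ext (\<lambda>r c. c * r) f"

definition q_to_1 :: "t_laurent \<Rightarrow> rat_fun" where
  "q_to_1 p = lin_ext (\<lambda>f c. Fract [:c:] 1 * t_var powi exp_deriv f) p"

definition has_limit_q_1 :: "t_field \<Rightarrow> rat_fun \<Rightarrow> bool" where
  "has_limit_q_1 F y \<longleftrightarrow>
     (\<exists>a\<in>diff_alg. \<exists>b\<in>diff_alg. F = Fract a b \<and> q_to_1 b \<noteq> 0 \<and> y = q_to_1 a / q_to_1 b)"

lemma exp_deriv_add: "exp_deriv (f + g) = exp_deriv f + exp_deriv g"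
  unfolding exp_deriv_def by (rule lin_ext_add) (auto simp: distrib_right)

lemma t_var_nonzero: "t_var \<noteq> 0"
  by (simp add: t_var_def Zero_fract_def eq_fract)

lemma q_to_1_add: "q_to_1 (a + b) = q_to_1 a + q_to_1 b"
  unfolding q_to_1_def
  by (rule lin_ext_add) (auto simp: Zero_fract_def[symmetric] distrib_right[symmetric])

lemma q_to_1_mult: "q_to_1 (a * b) = q_to_1 a * q_to_1 b"
  unfolding q_to_1_def
proof (rule lin_ext_mult)
  fix f g :: q_exp and c d :: rat
  have "Fract [:c * d:] 1 = Fract [:c:] 1 * Fract [:d:] 1"
    by (simp add: mult.commute)
  then show "Fract [:c * d:] 1 * t_var powi exp_deriv (f + g) =
      Fract [:c:] 1 * t_var powi exp_deriv f * (Fract [:d:] 1 * t_var powi exp_deriv g)"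
    by (simp only: exp_deriv_add power_int_add t_var_nonzero simp_thms mult_ac)
qed (auto simp: Zero_fract_def[symmetric] distrib_right[symmetric])

lemma q_to_1_gen: "q_to_1 (Poly_Mapping.single (q_pow r - q_pow s) 1) = t_var powi (r - s)"
proof -
  have "exp_deriv (q_pow r) = r" for r
    by (simp add: exp_deriv_def q_pow_def lin_ext_single)
  then have "exp_deriv (q_pow r - q_pow s) = r - s"
    using exp_deriv_add[of "q_pow r - q_pow s" "q_pow s"] by simp
  then show ?thesis
    by (simp add: q_to_1_def lin_ext_single Zero_fract_def[symmetric] one_pCons[symmetric]
        One_fract_def[symmetric])
qed

lemma has_limit_q_1_unique:
  assumes "has_limit_q_1 F y" "has_limit_q_1 F y'"
  shows "y = y'"
proof -
  obtain a b a' b' where F: "F = Fract a b" "F = Fract a' b'"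
    and nz: "q_to_1 b \<noteq> 0" "q_to_1 b' \<noteq> 0"
    and y: "y = q_to_1 a / q_to_1 b" "y' = q_to_1 a' / q_to_1 b'"
    using assms unfolding has_limit_q_1_def by blast
  have "b \<noteq> 0" "b' \<noteq> 0" using nz by (auto simp: q_to_1_def)
  then have "a * b' = a' * b" using F by (simp add: eq_fract)
  then show ?thesis using nz y by (simp add: frac_eq_eq flip: q_to_1_mult)
qed

end

theory Submission
  imports Defs
begin

text \<open>
  Put \<open>x\<^sub>m = t\<^bsup>q^m\<^esup>\<close>. The proof rests on two observations.

  First, the weight of a tableau is a product over its cells in which a cell of entry \<open>c\<close> and
  content \<open>a\<close> (column minus row) contributes
  \[ w(a,c) = \prod_{i=1}^{c} \frac{x_{a+k+1}-x_{a+k+1-i}}{x_{a+k}-x_{a+k-i}} . \]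
  Indeed the cells of one column of \<open>\<nu>\<^sup>(\<^sup>i\<^sup>)\<close> belong to one cell of the tableau; along that column the
  numerators and denominators of the brackets differ from these differences by monomials, whose
  product telescopes and is cancelled by the extra monomial of the bottom cell
  (\<open>column_wt_eq_brackets\<close>). The Frobenius twist \<open>\<phi>\<^bsup>\<mu>\<^sub>i-(i-1)\<^esup>\<close> turns the position within the row into
  the content (\<open>tableau_wt_eq_content_wt\<close>).

  Secondly, a Jacobi--Trudi identity holds for every weight that depends on content and entry
  only, in any commutative ring (\<open>jacobi_trudi_flag\<close>): the determinant
  whose entry in row \<open>i\<close> and column \<open>j\<close> is the generating function of single rows from content
  \<open>\<mu>\<^sub>j - j\<close> to content \<open>\<lambda>\<^sub>i - i\<close> is the generating function of the tableaux. A tableau is read as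
  a family of non-intersecting lattice paths whose horizontal steps are its cells. The
  determinant is expanded in a single column according to the first step of one path, and the
  next path to advance is chosen so that two paths which meet do so at the same moment; two
  columns of the matrix then agree and the term vanishes. On the side of tableaux the same step
  asks whether the first cell of a row has the largest value allowed there.

  It remains to see that the row generating function for \<open>w\<close> is the twisted \<open>H\<^sub>r\<close>. By Vandermonde's
  determinant \<open>H\<^sub>r\<close> is a product of ratios \<open>(x\<^bsub>k+r\<^esub> - x\<^bsub>k-i\<^esub>) / (x\<^sub>k - x\<^bsub>k-i\<^esub>)\<close> (\<open>complete_eq\<close>), and
  the row sums for \<open>w\<close> have the same closed form, as their recursion shows (\<open>row_gf_column_ratio\<close>).

  Both limits are multiplicative, so they can be taken for each monomial and each bracket
  separately. As \<open>t \<rightarrow> 1\<close> a monomial tends to \<open>1\<close> and a bracket to \<open>q\<close>; as \<open>q \<rightarrow> 1\<close> a bracket tends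
  to \<open>1\<close> and the monomial \<open>t\<^bsup>q^y-q^(y-c)\<^esup>\<close> to \<open>t\<^sup>c\<close>. An entry \<open>c\<close> has \<open>c\<close> brackets and one such monomial.
\<close>

section \<open>A Jacobi--Trudi identity with content-dependent weights\<close>

text \<open>
  The generating function of the weakly decreasing sequences of length \<open>r\<close> with entries in
  \<open>{0..<c}\<close>, placed at the contents \<open>a, a + 1, \<dots>\<close>. The recursion asks whether the first entry is
  the largest one allowed.
\<close>

fun row_gf :: "(int \<Rightarrow> nat \<Rightarrow> 'a::comm_ring_1) \<Rightarrow> nat \<Rightarrow> int \<Rightarrow> nat \<Rightarrow> 'a" where
  "row_gf w c a 0 = 1"
| "row_gf w 0 a (Suc r) = 0"
| "row_gf w (Suc c) a (Suc r) = row_gf w c a (Suc r) + w a c * row_gf w (Suc c) (a + 1) r"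

text \<open>
  The same, seen as a generating function of lattice paths from content \<open>a\<close> to content \<open>b\<close>. With
  the value \<open>0\<close> for \<open>b < a\<close> the recursion for the first step holds without exception.
\<close>

definition path_gf :: "(int \<Rightarrow> nat \<Rightarrow> 'a::comm_ring_1) \<Rightarrow> nat \<Rightarrow> int \<Rightarrow> int \<Rightarrow> 'a" where
  "path_gf w c a b = (if b < a then 0 else row_gf w c a (nat (b - a)))"

lemma path_gf_Suc:
  "path_gf w (Suc c) a b = path_gf w c a b + w a c * path_gf w (Suc c) (a + 1) b"
proof (cases "a < b")
  case True
  then have "nat (b - a) = Suc (nat (b - (a + 1)))" by simp
  with True show ?thesis by (simp add: path_gf_def)
qed (auto simp: path_gf_def)

lemma path_gf_0: "path_gf w 0 a b = (if a = b then 1 else 0)"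
proof (cases "a < b")
  case True
  then obtain r where "nat (b - a) = Suc r" by (cases "nat (b - a)") auto
  with True show ?thesis by (simp add: path_gf_def)
qed (auto simp: path_gf_def)

definition jt_det ::
    "(int \<Rightarrow> nat \<Rightarrow> 'a::comm_ring_1) \<Rightarrow> nat \<Rightarrow> (nat \<Rightarrow> nat) \<Rightarrow> (nat \<Rightarrow> nat) \<Rightarrow> (nat \<Rightarrow> nat) \<Rightarrow> 'a" where
  "jt_det w n c lam mu =
     det (mat n n (\<lambda>(i, j). path_gf w (c j) (int (mu j) - int j) (int (lam i) - int i)))"

lemma det_column_expand:
  fixes A :: "nat \<Rightarrow> nat \<Rightarrow> 'a::comm_ring_1"
  assumes "m < n" and "\<And>i. i < n \<Longrightarrow> A i m = B i m + s * C i m"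
    and "\<And>i j. i < n \<Longrightarrow> j < n \<Longrightarrow> j \<noteq> m \<Longrightarrow> A i j = B i j \<and> A i j = C i j"
  shows "det (mat n n (\<lambda>(i, j). A i j)) =
    det (mat n n (\<lambda>(i, j). B i j)) + s * det (mat n n (\<lambda>(i, j). C i j))"
proof -
  have det: "det (mat n n (\<lambda>(i, j). M i j)) =
      (\<Sum>p | p permutes {0..<n}. signof p * (\<Prod>j<n. M (p j) j))" for M :: "nat \<Rightarrow> nat \<Rightarrow> 'a"
  proof -
    have "(\<Prod>j<n. mat n n (\<lambda>(i, j). M i j) $$ (p j, j)) = (\<Prod>j<n. M (p j) j)"
      if "p permutes {0..<n}" for p
      using permutes_in_image[OF that] by (intro prod.cong) auto
    then show ?thesis
      by (subst det_col[of _ n]) simp_all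
  qed
  have "(\<Prod>j<n. A (p j) j) = (\<Prod>j<n. B (p j) j) + s * (\<Prod>j<n. C (p j) j)"
    if p: "p permutes {0..<n}" for p
  proof -
    have split: "(\<Prod>j<n. f j) = f m * (\<Prod>j\<in>{..<n} - {m}. f j)" for f :: "nat \<Rightarrow> 'a"
      using assms(1) by (intro prod.remove) auto
    have less: "p j < n" if "j < n" for j using permutes_in_image[OF p, of j] that by simp
    have "(\<Prod>j\<in>{..<n} - {m}. A (p j) j) = (\<Prod>j\<in>{..<n} - {m}. B (p j) j)"
      "(\<Prod>j\<in>{..<n} - {m}. A (p j) j) = (\<Prod>j\<in>{..<n} - {m}. C (p j) j)"
      by (rule prod.cong; use assms(3) less in force)+
    then show ?thesis
      unfolding split using assms(2)[OF less[OF assms(1)]] by (simp add: algebra_simps)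
  qed
  then have "(\<Sum>p | p permutes {0..<n}. signof p * (\<Prod>j<n. A (p j) j)) =
      (\<Sum>p | p permutes {0..<n}. signof p * (\<Prod>j<n. B (p j) j) +
        s * (signof p * (\<Prod>j<n. C (p j) j)))"
    by (intro sum.cong refl) (simp add: distrib_left mult.left_commute)
  then show ?thesis
    unfolding det by (simp only: sum.distrib sum_distrib_left)
qed

text \<open>
  The path that starts in column \<open>m\<close> of the matrix, at height \<open>d\<close>, either goes down by one or takes
  a horizontal step of weight \<open>w (\<mu>\<^sub>m - m) d\<close>.
\<close>

lemma jt_det_step:
  assumes m: "m < n" and c: "c m = Suc d"
  shows "jt_det w n c lam mu = jt_det w n (c(m := d)) lam mu +
    w (int (mu m) - int m) d * jt_det w n c lam (mu(m := Suc (mu m)))"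
  unfolding jt_det_def
proof (rule det_column_expand[OF m], goal_cases)
  case (1 i)
  have "int (Suc (mu m)) - int m = int (mu m) - int m + 1" by simp
  then show ?case by (simp only: fun_upd_same c) (rule path_gf_Suc)
qed auto

text \<open>
  A path that has gone past its end leaves a rectangle of zeros in rows \<open>m, \<dots>, n - 1\<close> and columns
  \<open>0, \<dots>, m\<close>, which is too large for a transversal to avoid. The hypothesis on \<open>mu\<close> allows \<open>mu\<close> to
  fail to be a partition by one cell in row \<open>m\<close>, because this is how the lemma meets it after a
  horizontal step of that row.
\<close>

lemma jt_det_zero_of_row_exceeded:
  assumes m: "m < n" and gt: "lam m < mu m"
    and lam: "\<And>i j. i < j \<Longrightarrow> j < n \<Longrightarrow> lam j \<le> lam i"
    and mu: "\<And>i. i < m \<Longrightarrow> mu m \<le> Suc (mu i)"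
  shows "jt_det w n c lam mu = 0"
proof -
  have z: "path_gf w (c j) (int (mu j) - int j) (int (lam i) - int i) = 0"
    if "m \<le> i" "i < n" "j \<le> m" for i j
  proof -
    have "lam i \<le> lam m" using lam[of m i] that by (cases "i = m") auto
    moreover have "mu m \<le> Suc (mu j)" if "j < m" using mu[OF that] .
    ultimately have "int (lam i) - int i < int (mu j) - int j"
      using gt that by (cases "j = m") force+
    then show ?thesis by (simp add: path_gf_def)
  qed
  have "(\<Prod>j<n. mat n n (\<lambda>(i, j). path_gf w (c j) (int (mu j) - int j)
      (int (lam i) - int i)) $$ (p j, j)) = 0" if p: "p permutes {0..<n}" for p
  proof -
    \<comment> \<open>The \<open>m + 1\<close> columns up to \<open>m\<close> cannot all be matched with the \<open>m\<close> rows before \<open>m\<close>.\<close>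
    have "\<exists>j\<le>m. m \<le> p j"
    proof (rule ccontr)
      assume "\<not> ?thesis"
      then have "p ` {..m} \<subseteq> {..<m}" by force
      from card_mono[OF _ this] have "card (p ` {..m}) \<le> m" by simp
      moreover have "card (p ` {..m}) = Suc m"
        using card_image[OF permutes_inj_on[OF p], of "{..m}"] by simp
      ultimately show False by simp
    qed
    then obtain j where j: "j \<le> m" "m \<le> p j" by blast
    moreover have "j < n" "p j < n" using j m permutes_in_image[OF p, of j] by auto
    ultimately show ?thesis using z by (intro prod_zero) (auto intro!: bexI[of _ j])
  qed
  then show ?thesis
    unfolding jt_det_def by (subst det_col[of _ n]) (auto intro!: sum.neutral)
qed

definition cells :: "nat \<Rightarrow> (nat \<Rightarrow> nat) \<Rightarrow> (nat \<Rightarrow> nat) \<Rightarrow> (nat \<times> nat) set" where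
  "cells n lam mu = {(i, j). i < n \<and> mu i \<le> j \<and> j < lam i}"

text \<open>
  The bound \<open>c\<close> on the entries depends on the row, so that the rows can be treated one after the
  other.
\<close>

definition flagged_tableaux ::
    "nat \<Rightarrow> (nat \<Rightarrow> nat) \<Rightarrow> (nat \<Rightarrow> nat) \<Rightarrow> (nat \<Rightarrow> nat) \<Rightarrow> (nat \<times> nat \<Rightarrow> nat) set" where
  "flagged_tableaux n c lam mu = {T \<in> (\<Pi>\<^sub>E x \<in> cells n lam mu. {..<c (fst x)}).
     (\<forall>i j j'. (i, j) \<in> cells n lam mu \<longrightarrow> (i, j') \<in> cells n lam mu \<longrightarrow> j < j' \<longrightarrow>
        T (i, j') \<le> T (i, j)) \<and>
     (\<forall>i i' j. (i, j) \<in> cells n lam mu \<longrightarrow> (i', j) \<in> cells n lam mu \<longrightarrow> i < i' \<longrightarrow>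
        T (i', j) < T (i, j))}"

definition content_wt ::
    "(int \<Rightarrow> nat \<Rightarrow> 'a::comm_ring_1) \<Rightarrow> (nat \<times> nat) set \<Rightarrow> (nat \<times> nat \<Rightarrow> nat) \<Rightarrow> 'a" where
  "content_wt w C T = (\<Prod>(i, j) \<in> C. w (int j - int i) (T (i, j)))"

lemma finite_cells [simp]: "finite (cells n lam mu)"
proof -
  have "cells n lam mu = Sigma {..<n} (\<lambda>i. {mu i..<lam i})" by (auto simp: cells_def)
  then show ?thesis by simp
qed

lemma finite_flagged_tableaux [simp]: "finite (flagged_tableaux n c lam mu)"
  unfolding flagged_tableaux_def
  by (rule finite_subset[OF _ finite_PiE[of "cells n lam mu" "\<lambda>x. {..<c (fst x)}"]]) auto

lemma flagged_tableaux_less: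
  "T \<in> flagged_tableaux n c lam mu \<Longrightarrow> (i, j) \<in> cells n lam mu \<Longrightarrow> T (i, j) < c i"
  by (force simp: flagged_tableaux_def)

lemma flagged_tableaux_outside:
  "T \<in> flagged_tableaux n c lam mu \<Longrightarrow> x \<notin> cells n lam mu \<Longrightarrow> T x = undefined"
  using PiE_arb[of T "cells n lam mu" "\<lambda>x. {..<c (fst x)}" x] by (simp add: flagged_tableaux_def)

lemma flagged_tableaux_row:
  "T \<in> flagged_tableaux n c lam mu \<Longrightarrow> (i, j) \<in> cells n lam mu \<Longrightarrow> (i, j') \<in> cells n lam mu \<Longrightarrow>
   j \<le> j' \<Longrightarrow> T (i, j') \<le> T (i, j)"
  by (cases "j = j'") (auto simp: flagged_tableaux_def)

lemma flagged_tableaux_column: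
  "T \<in> flagged_tableaux n c lam mu \<Longrightarrow> (i, j) \<in> cells n lam mu \<Longrightarrow> (i', j) \<in> cells n lam mu \<Longrightarrow>
   i < i' \<Longrightarrow> T (i', j) < T (i, j)"
  by (auto simp: flagged_tableaux_def)

lemma flagged_tableauxI:
  assumes "\<And>i j. (i, j) \<in> cells n lam mu \<Longrightarrow> T (i, j) < c i"
    and "\<And>x. x \<notin> cells n lam mu \<Longrightarrow> T x = undefined"
    and "\<And>i j j'. (i, j) \<in> cells n lam mu \<Longrightarrow> (i, j') \<in> cells n lam mu \<Longrightarrow> j < j' \<Longrightarrow>
        T (i, j') \<le> T (i, j)"
    and "\<And>i i' j. (i, j) \<in> cells n lam mu \<Longrightarrow> (i', j) \<in> cells n lam mu \<Longrightarrow> i < i' \<Longrightarrow>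
        T (i', j) < T (i, j)"
  shows "T \<in> flagged_tableaux n c lam mu"
  using assms unfolding flagged_tableaux_def by (auto simp: PiE_def extensional_def)

lemma flagged_tableaux_cong:
  assumes "\<And>i. i < n \<Longrightarrow> c i = c' i"
  shows "flagged_tableaux n c lam mu = flagged_tableaux n c' lam mu"
proof -
  have "(\<Pi>\<^sub>E x \<in> cells n lam mu. {..<c (fst x)}) = (\<Pi>\<^sub>E x \<in> cells n lam mu. {..<c' (fst x)})"
    using assms by (intro PiE_cong) (auto simp: cells_def)
  then show ?thesis by (simp add: flagged_tableaux_def)
qed

lemma jt_det_cong:
  assumes "\<And>i. i < n \<Longrightarrow> c i = c' i"
  shows "jt_det w n c lam mu = jt_det w n c' lam mu"
  unfolding jt_det_def using assms by (intro arg_cong[of _ _ det]) (auto intro!: eq_matI)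

text \<open>
  The bounds that occur: the rows before \<open>m\<close> are still to be searched for the entry \<open>d\<close>, the others
  are done with it.
\<close>

definition flag :: "nat \<Rightarrow> nat \<Rightarrow> nat \<Rightarrow> nat" where
  "flag d m i = (if i < m then Suc d else d)"

text \<open>
  Rows decrease weakly, so the value \<open>d\<close> is absent from row \<open>m\<close> as soon as it is absent from its
  first cell.
\<close>

lemma flagged_tableaux_lower_flag:
  assumes m: "m < n" and c: "c m = Suc d"
  shows "{T \<in> flagged_tableaux n c lam mu. \<not> (mu m < lam m \<and> T (m, mu m) = d)} =
    flagged_tableaux n (c(m := d)) lam mu"
proof (intro equalityI subsetI)
  fix T assume "T \<in> {T \<in> flagged_tableaux n c lam mu. \<not> (mu m < lam m \<and> T (m, mu m) = d)}"
  then have T: "T \<in> flagged_tableaux n c lam mu" and ne: "\<not> (mu m < lam m \<and> T (m, mu m) = d)"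
    by auto
  show "T \<in> flagged_tableaux n (c(m := d)) lam mu"
  proof (rule flagged_tableauxI, goal_cases)
    case (1 i j)
    show ?case
    proof (cases "i = m")
      case True
      then have f: "(m, mu m) \<in> cells n lam mu" "mu m \<le> j" using 1 by (auto simp: cells_def)
      then have "T (m, mu m) < d"
        using ne flagged_tableaux_less[OF T f(1)] c by (force simp: cells_def)
      then show ?thesis using flagged_tableaux_row[OF T f(1), of j] f(2) 1 True by simp
    qed (use flagged_tableaux_less[OF T 1] in auto)
  next
    case (2 x)
    then show ?case by (rule flagged_tableaux_outside[OF T])
  next
    case (3 i j j')
    then show ?case by (intro flagged_tableaux_row[OF T]) auto
  next
    case (4 i i' j)
    then show ?case by (rule flagged_tableaux_column[OF T])
  qed
next
  fix T assume T: "T \<in> flagged_tableaux n (c(m := d)) lam mu"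
  have "T \<in> flagged_tableaux n c lam mu"
  proof (rule flagged_tableauxI, goal_cases)
    case (1 i j)
    show ?case using flagged_tableaux_less[OF T 1] c by (auto split: if_splits)
  next
    case (2 x)
    then show ?case by (rule flagged_tableaux_outside[OF T])
  next
    case (3 i j j')
    then show ?case by (intro flagged_tableaux_row[OF T]) auto
  next
    case (4 i i' j)
    then show ?case by (rule flagged_tableaux_column[OF T])
  qed
  moreover have "T (m, mu m) \<noteq> d" if "mu m < lam m"
    using flagged_tableaux_less[OF T, of m "mu m"] that m by (simp add: cells_def)
  ultimately show "T \<in> {T \<in> flagged_tableaux n c lam mu. \<not> (mu m < lam m \<and> T (m, mu m) = d)}"
    by blast
qed

text \<open>
  If the first cell of row \<open>m\<close> has the largest value \<open>d\<close> allowed in that row, it can be removed. The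
  inverse operation always yields a tableau: the row to the right is bounded by \<open>d\<close>, the rows below
  have entries less than \<open>d\<close>, and by \<open>mu_m\<close> there is no cell above.
\<close>

lemma sum_tableaux_peel_cell:
  assumes m: "m < n" and less: "mu m < lam m"
    and mu_m: "\<And>i. i < m \<Longrightarrow> mu m < mu i"
  shows "(\<Sum>T | T \<in> flagged_tableaux n (flag d (Suc m)) lam mu \<and> T (m, mu m) = d.
            content_wt w (cells n lam mu) T) =
    w (int (mu m) - int m) d *
      (\<Sum>T \<in> flagged_tableaux n (flag d (Suc m)) lam (mu(m := Suc (mu m))).
         content_wt w (cells n lam (mu(m := Suc (mu m)))) T)"
proof -
  let ?x = "(m, mu m)" and ?mu = "mu(m := Suc (mu m))"
  let ?C = "cells n lam mu" and ?C' = "cells n lam ?mu"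
  let ?F = "flag d (Suc m)"
  have C: "?C = insert ?x ?C'" and x: "?x \<notin> ?C'"
    using m less by (auto simp: cells_def split: if_splits)
  have wt: "content_wt w ?C T = w (int (mu m) - int m) (T ?x) * content_wt w ?C' T" for T
    unfolding content_wt_def C by (subst prod.insert) (use x in auto)
  have wt': "content_wt w ?C' T = content_wt w ?C' T'" if "\<And>y. y \<in> ?C' \<Longrightarrow> T y = T' y" for T T'
    unfolding content_wt_def using that by (intro prod.cong) auto
  show ?thesis unfolding sum_distrib_left
  proof (rule sum.reindex_bij_witness[of _ "\<lambda>T. T(?x := d)" "\<lambda>T. T(?x := undefined)"], goal_cases)
    case (1 T)
    then show ?case by auto
  next
    case (2 T)
    then have T: "T \<in> flagged_tableaux n ?F lam mu" and Tx: "T ?x = d" by auto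
    show ?case
    proof (rule flagged_tableauxI, goal_cases)
      case (1 i j)
      then show ?case using flagged_tableaux_less[OF T, of i j] x C by auto
    next
      case (2 y)
      then show ?case using flagged_tableaux_outside[OF T, of y] C by auto
    next
      case (3 i j j')
      then show ?case using flagged_tableaux_row[OF T, of i j j'] x C by auto
    next
      case (4 i i' j)
      then show ?case using flagged_tableaux_column[OF T, of i j i'] x C by auto
    qed
  next
    case (3 T)
    then show ?case using flagged_tableaux_outside[OF 3 x] by auto
  next
    case (4 T)
    note T = 4
    have "T(?x := d) \<in> flagged_tableaux n ?F lam mu"
    proof (rule flagged_tableauxI, goal_cases)
      case (1 i j)
      then show ?case using flagged_tableaux_less[OF T, of i j] C by (auto simp: flag_def)
    next
      case (2 y)
      then show ?case using flagged_tableaux_outside[OF T, of y] C by auto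
    next
      case (3 i j j')
      have "(i, j') \<noteq> ?x" using 3 by (auto simp: cells_def)
      moreover from this have "(i, j') \<in> ?C'" using 3 C by auto
      moreover have "T (i, j') \<le> d" if "i = m"
        using flagged_tableaux_less[OF T \<open>(i, j') \<in> ?C'\<close>] that by (simp add: flag_def)
      ultimately show ?case using flagged_tableaux_row[OF T, of i j j'] 3 C by auto
    next
      case (4 i i' j)
      have "(i', j) \<noteq> ?x" using 4 mu_m[of i] by (auto simp: cells_def)
      moreover from this have "(i', j) \<in> ?C'" using 4 C by auto
      moreover have "T (i', j) < d" if "i = m"
        using flagged_tableaux_less[OF T \<open>(i', j) \<in> ?C'\<close>] that 4 by (simp add: flag_def)
      ultimately show ?case using flagged_tableaux_column[OF T, of i j i'] 4 C by auto
    qed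
    then show ?case by simp
  next
    case (5 T)
    then have "content_wt w ?C' (T(?x := undefined)) = content_wt w ?C' T"
      by (intro wt') (use x in auto)
    then show ?case using 5 by (simp add: wt)
  qed
qed

text \<open>
  When no value is left, a path cannot move, and the matrix records which starting points are end
  points. Unless \<open>\<lambda> = \<mu>\<close>, the first row in which they differ has its end point among none of the
  starting points.
\<close>

lemma jt_det_flag_0:
  assumes "\<And>i j. i < j \<Longrightarrow> j < n \<Longrightarrow> lam j \<le> lam i" and mu: "\<And>i j. i < j \<Longrightarrow> j < n \<Longrightarrow> mu j \<le> mu i"
    and le: "\<And>i. i < n \<Longrightarrow> mu i \<le> lam i" and c: "\<And>i. i < n \<Longrightarrow> c i = 0"
  shows "jt_det w n c lam mu =
    (\<Sum>T \<in> flagged_tableaux n c lam mu. content_wt w (cells n lam mu) T)"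
proof (cases "\<forall>i<n. mu i = lam i")
  case True
  then have e: "cells n lam mu = {}" by (auto simp: cells_def)
  then have "flagged_tableaux n c lam mu = {\<lambda>_. undefined}"
    by (auto simp: flagged_tableaux_def)
  then have "(\<Sum>T \<in> flagged_tableaux n c lam mu. content_wt w (cells n lam mu) T) = 1"
    by (simp add: e content_wt_def)
  moreover have "mat n n (\<lambda>(i, j). path_gf w (c j) (int (mu j) - int j) (int (lam i) - int i)) = 1\<^sub>m n"
  proof (rule eq_matI)
    fix i j assume "i < dim_row (1\<^sub>m n :: 'a mat)" "j < dim_col (1\<^sub>m n :: 'a mat)"
    then have ij: "i < n" "j < n" by auto
    have "int (mu j) - int j = int (lam i) - int i \<longleftrightarrow> i = j"
    proof
      assume eq: "int (mu j) - int j = int (lam i) - int i"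
      then have "int (mu j) - int j = int (mu i) - int i" using True ij by auto
      then show "i = j" using mu[of i j] mu[of j i] ij by (cases i j rule: linorder_cases) force+
    qed (use True ij in auto)
    then show "mat n n (\<lambda>(i, j). path_gf w (c j) (int (mu j) - int j) (int (lam i) - int i)) $$ (i, j) =
        1\<^sub>m n $$ (i, j)"
      using ij by (auto simp: path_gf_0 c)
  qed simp_all
  ultimately show ?thesis by (simp add: jt_det_def)
next
  case False
  define i where "i = (LEAST i. i < n \<and> mu i \<noteq> lam i)"
  have i: "i < n" "mu i \<noteq> lam i" using LeastI_ex[of "\<lambda>i. i < n \<and> mu i \<noteq> lam i"] False
    by (auto simp: i_def)
  have before: "mu j = lam j" if "j < i" for j
    using not_less_Least[of j "\<lambda>i. i < n \<and> mu i \<noteq> lam i"] that i(1) by (auto simp: i_def)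
  have lt: "mu i < lam i" using le[OF i(1)] i(2) by simp
  have "flagged_tableaux n c lam mu = {}"
  proof (rule ccontr)
    assume "flagged_tableaux n c lam mu \<noteq> {}"
    then obtain T where "T \<in> flagged_tableaux n c lam mu" by blast
    from flagged_tableaux_less[OF this, of i "mu i"] show False using i lt c by (simp add: cells_def)
  qed
  moreover have "jt_det w n c lam mu = 0"
  proof -
    have "int (mu j) - int j \<noteq> int (lam i) - int i" if "j < n" for j
    proof (cases i j rule: linorder_cases)
      case less
      then show ?thesis using mu[of i j] lt that by linarith
    next
      case greater
      then show ?thesis using assms(1)[of j i] before[of j] i(1) by linarith
    qed (use lt in simp)
    then have z: "path_gf w (c j) (int (mu j) - int j) (int (lam i) - int i) = 0" if "j < n" for j
      using that by (simp add: c path_gf_0)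
    show ?thesis unfolding jt_det_def
    proof (subst det_def'[of _ n], simp, intro sum.neutral ballI)
      fix p assume "p \<in> {p. p permutes {0..<n}}"
      then have "p i < n" using i(1) permutes_in_image[of p "{0..<n}" i] by auto
      then have "(\<Prod>i = 0..<n. mat n n (\<lambda>(i, j). path_gf w (c j) (int (mu j) - int j)
          (int (lam i) - int i)) $$ (i, p i)) = 0"
        using z i(1) by (intro prod_zero bexI[of _ i]) auto
      then show "signof p * (\<Prod>i = 0..<n. mat n n (\<lambda>(i, j). path_gf w (c j) (int (mu j) - int j)
          (int (lam i) - int i)) $$ (i, p i)) = 0"
        by simp
    qed
  qed
  ultimately show ?thesis by simp
qed

text \<open>
  Row \<open>m\<close> is the lowest one that may still contain \<open>d\<close>. Its cells of value \<open>d\<close> are peeled off one by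
  one, and \<open>IH\<close> takes over when it has none. The term of the horizontal step in the recursion for
  the determinant vanishes whenever no tableau can have such a cell: either row \<open>m\<close> is exhausted, or the cell
  would lie below another cell, and then the horizontal step runs into the start of the
  path of row \<open>m - 1\<close> at the same height.
\<close>

lemma jacobi_trudi_flag_step:
  assumes m: "m < n" and lam: "\<And>i j. i < j \<Longrightarrow> j < n \<Longrightarrow> lam j \<le> lam i"
    and IH: "\<And>mu. (\<And>i j. i < j \<Longrightarrow> j < n \<Longrightarrow> mu j \<le> mu i) \<Longrightarrow> (\<And>i. i < n \<Longrightarrow> mu i \<le> lam i) \<Longrightarrow>
      jt_det w n (flag d m) lam mu =
        (\<Sum>T \<in> flagged_tableaux n (flag d m) lam mu. content_wt w (cells n lam mu) T)"
    and mu: "\<And>i j. i < j \<Longrightarrow> j < n \<Longrightarrow> mu j \<le> mu i" and le: "\<And>i. i < n \<Longrightarrow> mu i \<le> lam i"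
  shows "jt_det w n (flag d (Suc m)) lam mu =
    (\<Sum>T \<in> flagged_tableaux n (flag d (Suc m)) lam mu. content_wt w (cells n lam mu) T)"
  using mu le
proof (induction "lam m - mu m" arbitrary: mu rule: less_induct)
  case (less mu)
  note mu = less.prems(1) and le = less.prems(2)
  let ?F = "flag d (Suc m)" and ?mu = "mu(m := Suc (mu m))"
  let ?S = "\<lambda>c mu. \<Sum>T \<in> flagged_tableaux n c lam mu. content_wt w (cells n lam mu) T"
  let ?top = "\<lambda>T. mu m < lam m \<and> T (m, mu m) = d"
  let ?R = "\<Sum>T | T \<in> flagged_tableaux n ?F lam mu \<and> ?top T. content_wt w (cells n lam mu) T"
  have F: "?F m = Suc d" "?F(m := d) = flag d m" by (auto simp: flag_def)
  have "?S ?F mu = ?R + (\<Sum>T | T \<in> flagged_tableaux n ?F lam mu \<and> \<not> ?top T.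
      content_wt w (cells n lam mu) T)"
    by (subst sum.union_disjoint[symmetric]) (auto intro!: sum.cong)
  also have "\<dots> = ?R + ?S (flag d m) mu"
    using flagged_tableaux_lower_flag[of m n ?F d lam mu, OF m F(1)] unfolding F(2) by simp
  also have "?S (flag d m) mu = jt_det w n (flag d m) lam mu"
    using IH[of mu] mu le by simp
  finally have S: "?S ?F mu = ?R + jt_det w n (flag d m) lam mu" .
  have "?R = w (int (mu m) - int m) d * jt_det w n ?F lam ?mu"
  proof (cases "mu m < lam m")
    case False
    then have eq: "lam m = mu m" using le[OF m] by simp
    have "jt_det w n ?F lam ?mu = 0"
    proof (rule jt_det_zero_of_row_exceeded[OF m])
      show "lam m < ?mu m" using eq by simp
      show "?mu m \<le> Suc (?mu i)" if "i < m" for i using mu[of i m] that m by simp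
    qed (rule lam)
    then show ?thesis using False by simp
  next
    case lt: True
    show ?thesis
    proof (cases "\<exists>i<m. mu i \<le> mu m")
      case True
      then obtain i where i: "i < m" "mu i = mu m" using mu m by (meson le_antisym)
      define k where "k = m - 1"
      have k: "k < m" "m = Suc k" "mu k = mu m" "k < n"
        using i mu[of k m] mu[of i k] m by (cases "i = k"; auto simp: k_def)+
      \<comment> \<open>The contents \<open>mu m + 1 - m\<close> and \<open>mu k - k\<close> agree, hence so do the two columns.\<close>
      have "jt_det w n ?F lam ?mu = 0" unfolding jt_det_def
        by (rule det_identical_columns[of _ n k m]) (use k m in \<open>auto intro!: eq_vecI simp: flag_def\<close>)
      moreover have "{T. T \<in> flagged_tableaux n ?F lam mu \<and> ?top T} = {}"
      proof -
        have False if T: "T \<in> flagged_tableaux n ?F lam mu" "T (m, mu m) = d" for T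
        proof -
          have c: "(k, mu m) \<in> cells n lam mu" "(m, mu m) \<in> cells n lam mu"
            using k m lt lam[of k m] by (auto simp: cells_def)
          from flagged_tableaux_column[OF T(1) c k(1)] flagged_tableaux_less[OF T(1) c(1)] T(2) k(1)
          show False by (simp add: flag_def)
        qed
        then show ?thesis by blast
      qed
      ultimately show ?thesis by (simp only: sum.empty mult_zero_right)
    next
      case False
      have "?R = w (int (mu m) - int m) d * ?S ?F ?mu"
        using sum_tableaux_peel_cell[of m n mu lam w d] m lt mu False by (simp add: not_le)
      also have "?S ?F ?mu = jt_det w n ?F lam ?mu"
      proof (rule less.hyps[symmetric])
        show "lam m - ?mu m < lam m - mu m" using lt by simp
        show "?mu j \<le> ?mu i" if "i < j" "j < n" for i j
          using mu[OF that] False that by (auto simp: not_le Suc_le_eq)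
        show "?mu i \<le> lam i" if "i < n" for i using le[OF that] lt by auto
      qed
      finally show ?thesis .
    qed
  qed
  then show ?case
    unfolding S jt_det_step[of m n ?F d w lam mu, OF m F(1)] F(2) by simp
qed

text \<open>
  The values are removed from the largest down, and within one value the rows from the bottom up.
  This order makes sure that a path never enters a point which another path has already left.
\<close>

lemma jacobi_trudi_flag:
  assumes lam: "\<And>i j. i < j \<Longrightarrow> j < n \<Longrightarrow> lam j \<le> lam i"
    and mu: "\<And>i j. i < j \<Longrightarrow> j < n \<Longrightarrow> mu j \<le> mu i"
    and le: "\<And>i. i < n \<Longrightarrow> mu i \<le> lam i" and m: "m \<le> n"
  shows "jt_det w n (flag d m) lam mu =
    (\<Sum>T \<in> flagged_tableaux n (flag d m) lam mu. content_wt w (cells n lam mu) T)"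
  using mu le m
proof (induction d arbitrary: m mu)
  case 0
  then show ?case
  proof (induction m arbitrary: mu)
    case 0
    then show ?case using lam by (intro jt_det_flag_0) (auto simp: flag_def)
  next
    case (Suc m)
    then show ?case using lam by (intro jacobi_trudi_flag_step) auto
  qed
next
  case (Suc d)
  note outer = Suc.IH
  show ?case using Suc.prems
  proof (induction m arbitrary: mu)
    case 0
    \<comment> \<open>Once all rows are done with \<open>d\<close>, the next smaller value is searched for in all rows.\<close>
    have "flag (Suc d) 0 i = flag d n i" if "i < n" for i using that by (simp add: flag_def)
    then show ?case
      using outer[of mu n] 0 jt_det_cong[of n "flag (Suc d) 0" "flag d n" w lam mu]
        flagged_tableaux_cong[of n "flag (Suc d) 0" "flag d n" lam mu] by simp
  next
    case (Suc m)
    then show ?case using lam by (intro jacobi_trudi_flag_step) auto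
  qed
qed

section \<open>Row sums for weights that are ratios of differences\<close>

text \<open>
  The closed form satisfies the recursion for the first entry: with \<open>X = x (a + r)\<close> the two
  contributions have the common factor \<open>\<Prod>i<c. X - x (a - i)\<close> (\<open>i \<ge> 1\<close>), and the remaining factors
  add up by \<open>(x a - x (a - c)) + (X - x a) = X - x (a - c)\<close>. Here the weight of the entry \<open>c\<close> is just
  what replaces the denominator for the starting point \<open>a + 1\<close> by the one for \<open>a\<close>.
\<close>

lemma row_gf_column_ratio:
  fixes x :: "int \<Rightarrow> 'a::field"
  assumes inj: "inj x"
    and w: "\<And>a c. w a c = (\<Prod>i = 1..c. (x (a + 1) - x (a + 1 - int i)) / (x a - x (a - int i)))"
  shows "row_gf w (Suc c) a r =
    (\<Prod>i = 1..c. (x (a + int r) - x (a - int i)) / (x a - x (a - int i)))"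
proof (induction r arbitrary: a c)
  case 0
  have "(\<Prod>i = 1..c. (x (a + int 0) - x (a - int i)) / (x a - x (a - int i))) = 1"
    by (rule prod.neutral) (auto simp: inj_eq[OF inj])
  then show ?case by simp
next
  case (Suc r)
  define N where "N c a z = (\<Prod>i = 1..c. z - x (a - int i))" for c a z
  have N_nonzero: "N c a (x a) \<noteq> 0" for c a
    by (auto simp: N_def inj_eq[OF inj])
  have N_Suc: "N (Suc c) a z = N c a z * (z - x (a - int (Suc c)))" for c a z
    by (simp add: N_def)
  have N_shift: "N (Suc c) (a + 1) z = (z - x a) * N c a z" for c a z
  proof (induction c)
    case (Suc c)
    have "a + 1 - int (Suc (Suc c)) = a - int (Suc c)" by simp
    then show ?case
      unfolding N_Suc[of "Suc c" "a + 1"] Suc.IH N_Suc[of c a] by (simp only: mult.assoc)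
  qed (simp add: N_def)
  have ratio: "(\<Prod>i = 1..c. (z - x (a - int i)) / (x a - x (a - int i))) = N c a z / N c a (x a)"
    for c a z by (simp add: N_def prod_dividef)
  have w': "w a c = N c (a + 1) (x (a + 1)) / N c a (x a)" for a c
    by (simp add: w N_def prod_dividef)
  let ?X = "x (a + int (Suc r))"
  have IH: "row_gf w (Suc c) (a + 1) r = N c (a + 1) ?X / N c (a + 1) (x (a + 1))" for c
    using Suc.IH[of c "a + 1"] unfolding ratio by (simp add: add_ac)
  have tail: "w a c * row_gf w (Suc c) (a + 1) r = N c (a + 1) ?X / N c a (x a)" for c
    unfolding IH w' using N_nonzero[of c "a + 1"] by simp
  have "row_gf w (Suc c) a (Suc r) = N c a ?X / N c a (x a)"
  proof (induction c)
    case 0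
    then show ?case using tail[of 0] by (simp add: N_def)
  next
    case (Suc c)
    have "x a - x (a - int (Suc c)) \<noteq> 0" by (simp add: inj_eq[OF inj])
    moreover have "row_gf w (Suc (Suc c)) a (Suc r) =
        N c a ?X / N c a (x a) + (?X - x a) * N c a ?X / N (Suc c) a (x a)"
      by (subst row_gf.simps(3)) (simp only: Suc.IH tail N_shift)
    ultimately show ?case
      using N_nonzero[of c a] unfolding N_Suc by (simp add: divide_simps) (simp add: algebra_simps)
  qed
  then show ?case unfolding ratio .
qed

section \<open>Vandermonde determinants\<close>

text \<open>
  As a function of the first node \<open>z\<close> the determinant is a polynomial \<open>p\<close> of degree at most \<open>n\<close>
  that vanishes at the other \<open>n\<close> nodes; its coefficient of degree \<open>n\<close> is, up to sign, the
  determinant of the other nodes. Isolating the first column is what the quotient of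
  determinants for \<open>H\<^sub>r\<close> needs, since only its first node depends on \<open>r\<close>.
\<close>

lemma vandermonde_first_column:
  fixes x :: "nat \<Rightarrow> 'a::field"
  assumes inj: "inj_on x {1..n}"
  shows "det (mat (Suc n) (Suc n) (\<lambda>(i, j). x j ^ i)) =
    det (mat n n (\<lambda>(i, j). x (Suc j) ^ i)) * (\<Prod>j = 1..n. x j - x 0)"
proof -
  let ?y = "\<lambda>z. x(0 := z)"
  let ?V = "\<lambda>z. mat (Suc n) (Suc n) (\<lambda>(i, j). ?y z j ^ i)"
  define c where "c i = cofactor (?V 0) i 0" for i
  define p where "p = (\<Sum>i\<le>n. monom (c i) i)"
  define q where "q = smult (c n) (\<Prod>j = 1..n. [:- x j, 1:])"
  have cof: "cofactor (?V z) i 0 = c i" if "i \<le> n" for z i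
  proof -
    have "mat_delete (?V z) i 0 = mat_delete (?V 0) i 0"
      by (rule eq_matI) (auto simp: mat_delete_def)
    then show ?thesis by (simp add: c_def cofactor_def)
  qed
  have p: "poly p z = det (?V z)" for z
  proof -
    have "det (?V z) = (\<Sum>i<Suc n. ?V z $$ (i, 0) * cofactor (?V z) i 0)"
      by (rule laplace_expansion_column) auto
    also have "\<dots> = (\<Sum>i\<le>n. z ^ i * c i)"
      unfolding lessThan_Suc_atMost by (intro sum.cong) (simp_all add: cof del: fun_upd_apply, simp)
    finally show ?thesis by (simp add: p_def poly_sum poly_monom mult.commute)
  qed
  have deg_p: "degree p \<le> n"
    unfolding p_def by (intro degree_sum_le) (auto intro: order_trans[OF degree_monom_le])
  have deg_prod: "degree (\<Prod>j = 1..n. [:- x j, 1:]) = n"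
    by (subst degree_prod_eq_sum_degree) auto
  have coeff_p: "coeff p n = c n"
    by (simp add: p_def coeff_sum)
  have "lead_coeff (\<Prod>j = 1..n. [:- x j, 1:]) = 1"
    by (simp add: lead_coeff_prod)
  then have coeff_q: "coeff q n = c n"
    using deg_prod by (simp add: q_def)
  have deg_q: "degree q \<le> n" using deg_prod degree_smult_le[of "c n"] by (simp add: q_def)
  \<comment> \<open>The two polynomials agree at \<open>n\<close> points and in degree \<open>n\<close>, so their difference is zero.\<close>
  have root: "poly (p - q) (x j) = 0" if "j \<in> {1..n}" for j
  proof -
    have "col (?V (x j)) 0 = col (?V (x j)) j" using that by (intro eq_vecI) auto
    then have "det (?V (x j)) = 0"
      using that by (intro det_identical_columns[of _ "Suc n" 0 j]) auto
    moreover have "poly q (x j) = 0"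
      using that by (auto simp: q_def poly_prod)
    ultimately show ?thesis by (simp add: p)
  qed
  have "p - q = 0"
  proof (rule ccontr)
    assume nz: "p - q \<noteq> 0"
    have "n = card (x ` {1..n})" using inj by (simp add: card_image)
    also have "\<dots> \<le> card {z. poly (p - q) z = 0}"
      using root poly_roots_finite[OF nz] by (intro card_mono) auto
    also have "\<dots> \<le> degree (p - q)" by (rule card_poly_roots_bound[OF nz])
    finally have "degree (p - q) = n" using degree_diff_le[OF deg_p deg_q] by simp
    then have "lead_coeff (p - q) = 0" using coeff_p coeff_q by simp
    then show False using nz unfolding leading_coeff_0_iff by blast
  qed
  then have "det (?V (x 0)) = poly q (x 0)" using p[of "x 0"] by simp
  also have "poly q (x 0) = c n * (\<Prod>j = 1..n. x 0 - x j)"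
    by (simp add: q_def poly_prod)
  also have "c n = (-1) ^ n * det (mat n n (\<lambda>(i, j). x (Suc j) ^ i))"
  proof -
    have "mat_delete (?V 0) n 0 = mat n n (\<lambda>(i, j). x (Suc j) ^ i)"
      by (rule eq_matI) (auto simp: mat_delete_def)
    then show ?thesis by (simp add: c_def cofactor_def)
  qed
  also have "(\<Prod>j = 1..n. x 0 - x j) = (-1) ^ n * (\<Prod>j = 1..n. x j - x 0)"
  proof -
    have "(\<Prod>j = 1..n. x 0 - x j) = (\<Prod>j = 1..n. (-1) * (x j - x 0))" by simp
    also have "\<dots> = (\<Prod>j = 1..n. -1) * (\<Prod>j = 1..n. x j - x 0)" by (rule prod.distrib)
    finally show ?thesis by simp
  qed
  finally show ?thesis
    by (simp add: fun_upd_triv mult_ac flip: power_mult_distrib)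
qed

lemma vandermonde_nonzero:
  fixes x :: "nat \<Rightarrow> 'a::field"
  assumes "inj_on x {..<n}"
  shows "det (mat n n (\<lambda>(i, j). x j ^ i)) \<noteq> 0"
  using assms
proof (induction n arbitrary: x)
  case (Suc n)
  have "inj_on x {1..n}" using Suc.prems by (rule inj_on_subset) auto
  moreover have "inj_on (\<lambda>j. x (Suc j)) {..<n}"
    using Suc.prems by (auto simp: inj_on_def)
  moreover have "x j \<noteq> x 0" if "j \<in> {1..n}" for j
    using Suc.prems that by (auto simp: inj_on_def)
  ultimately show ?case
    using Suc.IH[of "\<lambda>j. x (Suc j)"] by (simp add: vandermonde_first_column)
qed simp

section \<open>Powers of \<open>t\<close> and the Frobenius automorphism\<close>

abbreviation t_q :: "int \<Rightarrow> t_field" where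
  "t_q m \<equiv> t_pow (q_pow m)"

lemma t_pow_eq_iff: "t_pow f = t_pow g \<longleftrightarrow> f = g"
proof
  assume "t_pow f = t_pow g"
  then have "Poly_Mapping.single f (1::rat) = Poly_Mapping.single g 1"
    by (simp add: t_pow_def eq_fract)
  then show "f = g" by (metis lookup_single_eq lookup_single_not_eq zero_neq_one)
qed simp

lemma q_pow_eq_iff [simp]: "q_pow r = q_pow s \<longleftrightarrow> r = s"
  unfolding q_pow_def by (metis lookup_single_eq lookup_single_not_eq zero_neq_one)

lemma t_pow_diff: "t_pow (f - g) = t_pow f / t_pow g"
proof -
  have "t_pow g \<noteq> 0" by (simp add: t_pow_def Zero_fract_def eq_fract)
      (metis lookup_single_eq lookup_zero zero_neq_one)
  then show ?thesis using t_pow_add[of "f - g" g] by (simp add: field_simps)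
qed

lemma t_pow_nonzero: "t_pow g \<noteq> 0"
  using t_pow_diff[of g g] by (auto simp: t_pow_zero)

lemma q_pow_mult: "q_pow r * q_pow s = q_pow (r + s)"
  by (simp add: q_pow_def Poly_Mapping.mult_single)

lemma frob_laurent_add: "frob_laurent (a + b) = frob_laurent a + frob_laurent b"
  by (simp add: frob_laurent_def mon_map_add)

lemma frob_laurent_single: "frob_laurent (Poly_Mapping.single f c) = Poly_Mapping.single (q_pow 1 * f) c"
  by (simp add: frob_laurent_def)

lemma frob_laurent_one: "frob_laurent 1 = 1"
  using frob_laurent_single[of 0 1] by simp

lemma frob_t_pow_exp: "frob (t_pow f) = t_pow (q_pow 1 * f)"
  by (simp add: t_pow_def frob_Fract frob_laurent_one frob_laurent_single)

lemma field_isom_frob: "field_isom frob"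
proof
  show "frob 0 = 0"
    unfolding Zero_fract_def by (subst frob_Fract) (simp_all add: frob_laurent_def eq_fract)
  show "frob 1 = 1"
    unfolding One_fract_def by (simp add: frob_Fract frob_laurent_one)
  show "frob (x + y) = frob x + frob y" for x y
    by (cases x; cases y)
      (simp add: frob_Fract frob_laurent_add frob_laurent_mult frob_laurent_eq_0_iff)
  show "frob (x * y) = frob x * frob y" for x y
    by (cases x; cases y) (simp add: frob_Fract frob_laurent_mult)
  show "surj frob" using bij_frob by (rule bij_is_surj)
qed

lemma field_hom_funpow:
  fixes f :: "'a::field \<Rightarrow> 'a"
  assumes "field_hom f"
  shows "field_hom (f ^^ n)"
proof -
  interpret field_hom f by fact
  show ?thesis by standard (induction n; simp add: hom_distribs)+
qed

interpretation frob_pow: field_hom "frob_pow s" for s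
proof -
  interpret frob: field_isom frob by (rule field_isom_frob)
  have "field_hom (frob ^^ n)" "field_hom (inv_into UNIV frob ^^ n)" for n
    by (intro field_hom_funpow; unfold_locales)+
  then show "field_hom (frob_pow s)" by (simp add: frob_pow_def)
qed

lemma frob_pow_t_pow: "frob_pow s (t_pow f) = t_pow (q_pow s * f)"
proof -
  have 0: "q_pow 0 = 1" by (simp add: q_pow_def single_one)
  have "(frob ^^ n) (t_pow f) = t_pow (q_pow (int n) * f)" for n
    by (induction n) (simp_all add: 0 frob_t_pow_exp q_pow_mult flip: mult.assoc)
  moreover have inverse: "inv_into UNIV frob (t_pow g) = t_pow (q_pow (-1) * g)" for g
    by (rule inv_f_eq) (simp_all add: bij_is_inj bij_frob frob_t_pow_exp q_pow_inverse)
  have "(inv_into UNIV frob ^^ n) (t_pow f) = t_pow (q_pow (- int n) * f)" for n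
    by (induction n) (simp_all add: 0 inverse q_pow_mult flip: mult.assoc)
  ultimately show ?thesis by (simp add: frob_pow_def)
qed

lemma frob_pow_t_q: "frob_pow s (t_q r) = t_q (r + s)"
  by (simp add: frob_pow_t_pow q_pow_mult add.commute)

section \<open>Complete functions, rows and columns\<close>

text \<open>
  Numerator and denominator of \<open>H\<^sub>r\<close> are Vandermonde determinants that differ in the first node
  only, so that the determinants of the remaining nodes cancel.
\<close>

lemma complete_eq:
  "complete k (int r) = (\<Prod>j = 1..k. (t_q (int k + int r) - t_q (int k - int j)) /
     (t_q (int k) - t_q (int k - int j)))"
proof -
  define x where "x j = t_q (int k - int j)" for j :: nat
  define y where "y = x(0 := t_q (int k + int r))"
  have inj: "inj_on x A" for A by (auto simp: inj_on_def x_def t_pow_eq_iff)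
  have "inj_on y {1..k}" by (auto simp: inj_on_def x_def y_def t_pow_eq_iff)
  have nu: "int ((r # replicate k 0) ! j) + int (k + 1) - 1 - int j =
      (if j = 0 then int k + int r else int k - int j)" if "j < k + 1" for j
    using that by (cases j) auto
  have nz: "det (mat k k (\<lambda>(i, j). x (Suc j) ^ i)) \<noteq> 0"
    by (rule vandermonde_nonzero) (auto simp: x_def inj_on_def t_pow_eq_iff)
  have "complete k (int r) = det (mat (k + 1) (k + 1) (\<lambda>(i, j). y j ^ i)) /
      det (mat (k + 1) (k + 1) (\<lambda>(i, j). x j ^ i))"
    unfolding complete_def schur_def nat_int
    by (auto intro!: arg_cong2[of _ _ _ _ "(/)"] arg_cong[of _ _ det] eq_matI
        simp: nu x_def y_def add.commute)
  also have "\<dots> = (\<Prod>j = 1..k. y j - y 0) / (\<Prod>j = 1..k. x j - x 0)"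
    using vandermonde_first_column[OF \<open>inj_on y {1..k}\<close>] vandermonde_first_column[OF inj]
nz
    by (simp add: y_def)
  also have "\<dots> = (\<Prod>j = 1..k. (y 0 - y j) / (x 0 - x j))"
    unfolding prod_dividef[symmetric]
    by (rule prod.cong[OF refl]) (metis minus_diff_eq minus_divide_divide)
  also have "\<dots> = (\<Prod>j = 1..k. (t_q (int k + int r) - t_q (int k - int j)) /
     (t_q (int k) - t_q (int k - int j)))"
    by (rule prod.cong) (auto simp: x_def y_def)
  finally show ?thesis .
qed

text \<open>
  What a column of height \<open>c\<close> contributes to the weight of a partition, where \<open>y\<close> is the column
  index, counted from \<open>0\<close>, plus \<open>k\<close>.
\<close>

definition column_wt :: "int \<Rightarrow> nat \<Rightarrow> t_field" where
  "column_wt y c = (\<Prod>i = 1..c. (t_q (y + 1) - t_q (y + 1 - int i)) / (t_q y - t_q (y - int i)))"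

lemma frob_pow_column_wt: "frob_pow s (column_wt y c) = column_wt (y + s) c"
  by (simp add: column_wt_def frob_pow.hom_prod frob_pow.hom_div frob_pow.hom_minus frob_pow_t_q
      algebra_simps)

text \<open>
  With \<open>x\<^sub>m = t\<^bsup>q^m\<^esup>\<close> the bracket of \<open>x\<^sub>y / x\<^bsub>y-i\<^esub>\<close> is
  \<open>(x\<^bsub>y+1-i\<^esub> - x\<^bsub>y+1\<^esub>) / (x\<^bsub>y-i\<^esub> - x\<^sub>y) \<cdot> x\<^bsub>y-i\<^esub> / x\<^bsub>y+1-i\<^esub>\<close>, and the last factors
  telescope to \<open>x\<^bsub>y-c\<^esub> / x\<^sub>y\<close>.
\<close>

lemma column_wt_eq_brackets:
  "column_wt y c = t_pow (q_pow y - q_pow (y - int c)) *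
     (\<Prod>i = 1..c. q_bracket (t_pow (q_pow y - q_pow (y - int i))))"
proof (induction c)
  case 0
  then show ?case by (simp add: column_wt_def t_pow_zero)
next
  case (Suc c)
  have ne: "t_q y \<noteq> t_q (y - 1 - int c)" by (simp add: t_pow_eq_iff)
  let ?e = "\<lambda>c. t_pow (q_pow y - q_pow (y - int c))"
  let ?r = "(t_q (y + 1) - t_q (y + 1 - int (Suc c))) / (t_q y - t_q (y - int (Suc c)))"
  have step: "?e c * ?r = ?e (Suc c) * q_bracket (?e (Suc c))"
    using ne unfolding q_bracket_def frob_t_pow_exp right_diff_distrib q_pow_mult
    by (simp add: t_pow_diff t_pow_nonzero divide_simps)
      (simp add: algebra_simps)
  have "column_wt y (Suc c) = column_wt y c * ?r" by (simp add: column_wt_def)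
  also have "\<dots> = (?e c * ?r) * (\<Prod>i = 1..c. q_bracket (?e i))"
    by (simp only: Suc.IH mult_ac)
  also have "\<dots> = ?e (Suc c) * (\<Prod>i = 1..Suc c. q_bracket (?e i))"
    unfolding step by (simp add: mult_ac)
  finally show ?case .
qed

text \<open>
  The product over the Ferrers diagram is taken column by column. The monomial \<open>?e (cs ! j)\<close> of
  the bottom cell is \<open>1\<close> for an empty column, so that empty columns need no separate case.
\<close>

lemma partition_wt_of_columns:
  assumes "sorted_wrt (\<ge>) cs"
  shows "partition_wt k (of_columns cs) = (\<Prod>j<length cs. column_wt (int j + int k) (cs ! j))"
proof -
  have F: "ferrers (of_columns cs) =
      (\<lambda>(j, i). (i, Suc j)) ` Sigma {..<length cs} (\<lambda>j. {1..cs ! j})"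
    using ferrers_of_columns[OF assms] by (force simp: image_iff gr0_conv_Suc)
  have "partition_wt k (of_columns cs) =
      (\<Prod>(j, i) \<in> Sigma {..<length cs} (\<lambda>j. {1..cs ! j}). cell_wt k (of_columns cs) (i, Suc j))"
    unfolding partition_wt_def F
    by (subst prod.reindex) (auto simp: inj_on_def case_prod_unfold intro!: prod.cong)
  also have "\<dots> = (\<Prod>j<length cs. \<Prod>i = 1..cs ! j. cell_wt k (of_columns cs) (i, Suc j))"
    by (rule prod.Sigma[symmetric]) auto
  also have "\<dots> = (\<Prod>j<length cs. column_wt (int j + int k) (cs ! j))"
  proof (rule prod.cong[OF refl])
    fix j assume "j \<in> {..<length cs}"
    then have j: "j < length cs" by simp
    let ?e = "\<lambda>i. t_pow (q_pow (int j + int k) - q_pow (int j + int k - int i))"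
    have e: "t_pow (cell_exp k (i, Suc j)) = ?e i" for i
      by (simp add: cell_exp_def depth_def algebra_simps)
    have bottom: "(Suc i, Suc j) \<notin> ferrers (of_columns cs) \<longleftrightarrow> cs ! j \<le> i" for i
      using ferrers_of_columns[OF assms] j by auto
    have "(\<Prod>i = 1..cs ! j. cell_wt k (of_columns cs) (i, Suc j)) =
        (\<Prod>i = 1..cs ! j. if cs ! j = i then ?e i else 1) * (\<Prod>i = 1..cs ! j. q_bracket (?e i))"
      unfolding prod.distrib[symmetric]
      by (intro prod.cong) (auto simp: cell_wt_def e bottom)
    also have "(\<Prod>i = 1..cs ! j. if cs ! j = i then ?e i else 1) = ?e (cs ! j)"
      by (subst prod.delta') (auto simp: t_pow_zero not_le)
    finally show "(\<Prod>i = 1..cs ! j. cell_wt k (of_columns cs) (i, Suc j)) =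
        column_wt (int j + int k) (cs ! j)"
      by (simp add: column_wt_eq_brackets)
  qed
  finally show ?thesis .
qed

definition entry_wt :: "nat \<Rightarrow> int \<Rightarrow> nat \<Rightarrow> t_field" where
  "entry_wt k a c = column_wt (a + int k) c"

text \<open>
  Paths with heights in \<open>{0..k}\<close> from content \<open>a\<close> to content \<open>b\<close> have the generating function
  \<open>\<phi>\<^sup>a H\<^bsub>b-a\<^esub>\<close>, since both sides are the same product.
\<close>

lemma frob_pow_complete_eq_path_gf:
  "frob_pow a (complete k (b - a)) = path_gf (entry_wt k) (Suc k) a b"
proof (cases "b < a")
  case True
  then show ?thesis by (simp add: complete_def path_gf_def)
next
  case False
  then obtain r where r: "b - a = int r" by (metis diff_ge_0_iff_ge not_less zero_le_imp_eq_int)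
  have "inj (\<lambda>m. t_q (m + int k))" by (auto simp: inj_def t_pow_eq_iff)
  from row_gf_column_ratio[OF this, of "entry_wt k" k a r]
  have "row_gf (entry_wt k) (Suc k) a r =
    (\<Prod>i = 1..k. (t_q (a + int r + int k) - t_q (a - int i + int k)) /
        (t_q (a + int k) - t_q (a - int i + int k)))"
    by (simp add: entry_wt_def column_wt_def algebra_simps)
  also have "\<dots> = frob_pow a (complete k (int r))"
    by (simp add: complete_eq frob_pow.hom_prod frob_pow.hom_div frob_pow.hom_minus frob_pow_t_q
      algebra_simps)
  finally show ?thesis using False by (simp add: path_gf_def r)
qed

lemma skew_schur_eq_jt_det:
  "skew_schur k lam mu = jt_det (entry_wt k) (length lam) (\<lambda>_. Suc k) ((!) lam) ((!) mu)"
  unfolding skew_schur_def jt_det_def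
proof (intro arg_cong[of _ _ det] cong_mat refl, clarsimp)
  fix i j
  show "frob_pow (int (mu ! j) - int j) (complete k (int (lam ! i) - int (mu ! j) - int i + int j)) =
    path_gf (entry_wt k) (Suc k) (int (mu ! j) - int j) (int (lam ! i) - int i)"
    unfolding frob_pow_complete_eq_path_gf[symmetric] by (simp add: algebra_simps)
qed

lemma skew_cells_eq_cells: "skew_cells lam mu = cells (length lam) ((!) lam) ((!) mu)"
  by (simp add: skew_cells_def cells_def)

lemma tableaux_eq_flagged_tableaux:
  "tableaux k lam mu = flagged_tableaux (length lam) (\<lambda>_. Suc k) ((!) lam) ((!) mu)"
  unfolding tableaux_def flagged_tableaux_def skew_cells_eq_cells
  by (simp add: atLeast0AtMost lessThan_Suc_atMost)

text \<open>
  In row \<open>i\<close> the twist moves the \<open>j\<close>-th column of the partition from \<open>j + k\<close> to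
  \<open>j + k + \<mu>\<^sub>i - i\<close>, and the entry in question stands in column \<open>\<mu>\<^sub>i + j\<close> of the tableau.
\<close>

lemma tableau_wt_eq_content_wt:
  assumes T: "T \<in> tableaux k lam mu"
  shows "tableau_wt k lam mu T = content_wt (entry_wt k) (skew_cells lam mu) T"
proof -
  have row: "frob_pow (int (mu ! i) - int i) (partition_wt k (row_partition lam mu T i)) =
      (\<Prod>j = mu ! i..<lam ! i. entry_wt k (int j - int i) (T (i, j)))" if i: "i < length lam" for i
  proof -
    let ?cs = "map (\<lambda>j. T (i, j)) [mu ! i..<lam ! i]"
    have "sorted_wrt (\<ge>) ?cs"
      using T i unfolding tableaux_def skew_cells_def sorted_wrt_iff_nth_less by auto
    then have "frob_pow (int (mu ! i) - int i) (partition_wt k (of_columns ?cs)) =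
        (\<Prod>j<lam ! i - mu ! i. column_wt (int j + int k + (int (mu ! i) - int i)) (T (i, mu ! i + j)))"
      by (simp add: partition_wt_of_columns frob_pow.hom_prod frob_pow_column_wt)
    also have "\<dots> = (\<Prod>j = mu ! i..<lam ! i. entry_wt k (int j - int i) (T (i, j)))"
      by (rule prod.reindex_bij_witness[of _ "\<lambda>j. j - mu ! i" "\<lambda>j. j + mu ! i"])
        (auto simp: entry_wt_def algebra_simps)
    finally show ?thesis by (simp add: row_partition_def)
  qed
  have "skew_cells lam mu = Sigma {..<length lam} (\<lambda>i. {mu ! i..<lam ! i})"
    by (auto simp: skew_cells_def)
  then show ?thesis
    unfolding tableau_wt_def content_wt_def
    by (simp add: prod.Sigma[symmetric] row)
qed

section \<open>The two limits\<close>

lemma has_limit_t_1_mult: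
  assumes "has_limit_t_1 q F c" "has_limit_t_1 q F' c'"
  shows "has_limit_t_1 q (F * F') (c * c')"
proof -
  have i: "interpreted_as q (F * F') (G * G')" if "interpreted_as q F G" "interpreted_as q F' G'" for G G'
  proof -
    from that obtain a b a' b' where "F = Fract a b" "F' = Fract a' b'"
      "actual_powers q b \<noteq> 0" "actual_powers q b' \<noteq> 0"
      "G = Fract (actual_powers q a) (actual_powers q b)"
      "G' = Fract (actual_powers q a') (actual_powers q b')"
      unfolding interpreted_as_def by blast
    then show ?thesis unfolding interpreted_as_def
      by (intro exI[of _ "a * a'"] exI[of _ "b * b'"]) (simp add: actual_powers_mult)
  qed
  have v: "value_at_one (G * G') (c * c')" if "value_at_one G c" "value_at_one G' c'" for G G'
  proof -
    from that obtain a b a' b' where "G = Fract a b" "G' = Fract a' b'"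
      "at_one b \<noteq> 0" "at_one b' \<noteq> 0" "c = at_one a / at_one b" "c' = at_one a' / at_one b'"
      unfolding value_at_one_def by blast
    then show ?thesis unfolding value_at_one_def
      by (intro exI[of _ "a * a'"] exI[of _ "b * b'"]) (simp add: at_one_mult)
  qed
  show ?thesis using assms i v unfolding has_limit_t_1_def by blast
qed

lemma actual_powers_one: "actual_powers q 1 = 1"
  by (metis actual_powers_mult actual_powers_def mon_map_single mult_1 single_one exp_eval_def lin_ext_zero)

lemma actual_powers_single: "actual_powers q (Poly_Mapping.single f c) = Poly_Mapping.single (exp_eval (of_nat q) f) c"
  by (simp add: actual_powers_def)

lemma actual_powers_diff: "actual_powers q (a - b) = actual_powers q a - actual_powers q b"
  using mon_map_add[of "exp_eval (of_nat q)" "a - b" b] by (simp add: actual_powers_def eq_diff_eq)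

lemma at_one_single: "at_one (Poly_Mapping.single f c) = c"
  by (simp add: at_one_def lin_ext_single)

lemma at_one_one: "at_one 1 = 1"
  using at_one_single[of 0 1] by simp

lemma at_one_sum: "at_one (sum f A) = (\<Sum>i\<in>A. at_one (f i))"
proof -
  have "at_one (a + b) = at_one a + at_one b" for a b
    unfolding at_one_def by (rule lin_ext_add) auto
  then show ?thesis
    by (induction A rule: infinite_finite_induct) (simp_all add: at_one_def)
qed

lemma at_one_power: "at_one (p ^ n) = at_one p ^ n"
  by (induction n) (simp_all add: at_one_one at_one_mult)

lemma has_limit_t_1_t_pow: "has_limit_t_1 q (t_pow f) 1"
proof -
  have "interpreted_as q (t_pow f) (Fract (Poly_Mapping.single (exp_eval (of_nat q) f) 1) 1)"
    unfolding interpreted_as_def t_pow_def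
    by (intro exI[of _ "Poly_Mapping.single f 1"] exI[of _ 1])
      (simp add: actual_powers_single actual_powers_one)
  moreover have "value_at_one (Fract (Poly_Mapping.single (exp_eval (of_nat q) f) 1) 1) 1"
    unfolding value_at_one_def
    by (intro exI[of _ "Poly_Mapping.single (exp_eval (of_nat q) f) 1"] exI[of _ 1])
      (simp add: at_one_single at_one_one)
  ultimately show ?thesis unfolding has_limit_t_1_def by blast
qed

lemma has_limit_t_1_prod:
  assumes "\<And>x. x \<in> A \<Longrightarrow> has_limit_t_1 q (F x) (c x)"
  shows "has_limit_t_1 q (prod F A) (prod c A)"
  using assms
proof (induction A rule: infinite_finite_induct)
  case (insert x A)
  then show ?case by (simp add: has_limit_t_1_mult)
qed (use has_limit_t_1_t_pow[of q 0] in \<open>simp_all add: t_pow_zero\<close>)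

lemma q_bracket_t_pow:
  assumes "f \<noteq> 0"
  shows "q_bracket (t_pow f) =
    Fract (1 - Poly_Mapping.single (q_pow 1 * f) 1) (1 - Poly_Mapping.single f 1)"
proof -
  have "1 - Poly_Mapping.single f 1 \<noteq> (0::t_laurent)"
    using assms by (metis eq_iff_diff_eq_0 lookup_single_eq lookup_single_not_eq single_one zero_neq_one)
  then show ?thesis
    unfolding q_bracket_def frob_t_pow_exp by (simp add: t_pow_def One_fract_def)
qed

lemma exp_eval_q_pow: "exp_eval x (q_pow r) = x powi r"
  by (simp add: exp_eval_def q_pow_def lin_ext_single)

lemma exp_eval_diff: "exp_eval x (f - g) = exp_eval x f - exp_eval x g"
  using exp_eval_add[of x "f - g" g] by simp

lemma single_power: "Poly_Mapping.single (a::rat) (1::rat) ^ n = Poly_Mapping.single (of_nat n * a) 1"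
  by (induction n) (simp_all add: single_one Poly_Mapping.mult_single distrib_right)

text \<open>
  For the integer \<open>q\<close> the exponent \<open>E\<close> of \<open>u = t\<^sup>E\<close> is a nonzero rational number and the Frobenius
  automorphism multiplies it by \<open>q\<close>. The bracket is \<open>1 + u + \<dots> + u\<^bsup>q-1\<^esup>\<close>.
\<close>

lemma has_limit_t_1_q_bracket:
  assumes q: "2 \<le> q" and i: "1 \<le> i"
  shows "has_limit_t_1 q (q_bracket (t_pow (q_pow y - q_pow (y - int i)))) (of_nat q)"
proof -
  let ?f = "q_pow y - q_pow (y - int i)"
  let ?q = "of_nat q :: rat"
  define E where "E = exp_eval ?q ?f"
  define u :: "rat \<Rightarrow>\<^sub>0 rat" where "u = Poly_Mapping.single E 1"
  have qE: "exp_eval ?q (q_pow 1 * ?f) = ?q * E"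
    using q by (simp add: E_def right_diff_distrib q_pow_mult exp_eval_diff exp_eval_q_pow
        power_int_add power_int_diff algebra_simps)
  have "?q powi (y - int i) < ?q powi y"
    using q i by (intro power_int_strict_increasing) auto
  then have "E \<noteq> 0" by (simp add: E_def exp_eval_diff exp_eval_q_pow)
  then have u: "1 - u \<noteq> 0"
    unfolding u_def by (metis eq_iff_diff_eq_0 lookup_single_eq lookup_single_not_eq single_one zero_neq_one)
  have "interpreted_as q (q_bracket (t_pow ?f)) (Fract (1 - u ^ q) (1 - u))"
    unfolding interpreted_as_def
    by (rule exI[of _ "1 - Poly_Mapping.single (q_pow 1 * ?f) 1"],
        rule exI[of _ "1 - Poly_Mapping.single ?f 1"])
      (use u i in \<open>simp add: q_bracket_t_pow actual_powers_diff actual_powers_one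
        actual_powers_single qE single_power u_def E_def\<close>)
  moreover have "Fract (1 - u ^ q) (1 - u) = Fract (\<Sum>i<q. u ^ i) 1"
    using u by (simp add: eq_fract one_diff_power_eq mult.commute)
  moreover have "value_at_one (Fract (\<Sum>i<q. u ^ i) 1) ?q"
    unfolding value_at_one_def
    by (rule exI[of _ "\<Sum>i<q. u ^ i"], rule exI[of _ 1])
      (simp add: at_one_sum at_one_power at_one_one at_one_single u_def)
  ultimately show ?thesis unfolding has_limit_t_1_def by auto
qed

lemma has_limit_t_1_column_wt:
  assumes "2 \<le> q"
  shows "has_limit_t_1 q (column_wt y c) (of_nat q ^ c)"
proof -
  have "has_limit_t_1 q (\<Prod>i = 1..c. q_bracket (t_pow (q_pow y - q_pow (y - int i))))
      (\<Prod>i = 1..c. of_nat q)"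
    using assms by (intro has_limit_t_1_prod has_limit_t_1_q_bracket) auto
  from has_limit_t_1_mult[OF has_limit_t_1_t_pow this, of "q_pow y - q_pow (y - int c)"]
  show ?thesis by (simp add: column_wt_eq_brackets)
qed

lemma has_limit_q_1_mult:
  assumes "has_limit_q_1 F z" "has_limit_q_1 F' z'"
  shows "has_limit_q_1 (F * F') (z * z')"
proof -
  from assms obtain a b a' b' where "F = Fract a b" "F' = Fract a' b'"
    "a \<in> diff_alg" "b \<in> diff_alg" "a' \<in> diff_alg" "b' \<in> diff_alg"
    "q_to_1 b \<noteq> 0" "q_to_1 b' \<noteq> 0" "z = q_to_1 a / q_to_1 b" "z' = q_to_1 a' / q_to_1 b'"
    unfolding has_limit_q_1_def by blast
  then show ?thesis unfolding has_limit_q_1_def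
    by (intro bexI[of _ "a * a'"] bexI[of _ "b * b'"]) (auto simp: q_to_1_mult diff_alg.mult)
qed

lemma q_to_1_const: "q_to_1 (Poly_Mapping.single 0 c) = Fract [:c:] 1"
  by (simp add: q_to_1_def lin_ext_single exp_deriv_def flip: Zero_fract_def)

lemma one_in_diff_alg: "1 \<in> diff_alg"
  using diff_alg.const[of 1] by simp

lemma q_to_1_one: "q_to_1 1 = 1"
  using q_to_1_const[of 1] by (simp add: One_fract_def one_pCons)

lemma has_limit_q_1_t_pow: "has_limit_q_1 (t_pow (q_pow r - q_pow s)) (t_var powi (r - s))"
  unfolding has_limit_q_1_def t_pow_def
  by (rule bexI[of _ "Poly_Mapping.single (q_pow r - q_pow s) 1"], rule bexI[of _ 1])
    (auto simp: q_to_1_one q_to_1_gen one_in_diff_alg intro: diff_alg.gen)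

lemma has_limit_q_1_prod:
  assumes "\<And>x. x \<in> A \<Longrightarrow> has_limit_q_1 (F x) (z x)"
  shows "has_limit_q_1 (prod F A) (prod z A)"
  using assms
proof (induction A rule: infinite_finite_induct)
  case (insert x A)
  then show ?case by (simp add: has_limit_q_1_mult)
qed (use has_limit_q_1_t_pow[of 0 0] in \<open>simp_all add: t_pow_zero\<close>)

lemma one_minus_gen:
  "1 - Poly_Mapping.single (q_pow r - q_pow s) 1 \<in> diff_alg"
  "q_to_1 (1 - Poly_Mapping.single (q_pow r - q_pow s) 1) = 1 - t_var powi (r - s)"
proof -
  let ?m = "Poly_Mapping.single (q_pow r - q_pow s) 1 :: t_laurent"
  have eq: "1 - ?m = 1 + Poly_Mapping.single 0 (- 1) * ?m"
    by (simp add: Poly_Mapping.mult_single flip: single_uminus)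
  show "1 - ?m \<in> diff_alg"
    unfolding eq by (intro diff_alg.add diff_alg.mult diff_alg.const diff_alg.gen one_in_diff_alg)
  show "q_to_1 (1 - ?m) = 1 - t_var powi (r - s)"
    using q_to_1_add[of "1 - ?m" ?m] by (simp add: q_to_1_one q_to_1_gen)
qed

text \<open>
  This keeps the denominators of the brackets from vanishing in the limit.
\<close>

lemma t_var_power_neq_1: "1 \<le> i \<Longrightarrow> t_var ^ i \<noteq> 1"
proof
  assume i: "1 \<le> i" and eq: "t_var ^ i = 1"
  have "t_var ^ i = Fract ([:0, 1:] ^ i) 1"
    by (induction i) (simp_all add: t_var_def One_fract_def)
  with eq have "([:0, 1:] :: rat poly) ^ i = 1" by (simp add: One_fract_def eq_fract)
  then have "poly ([:0, 1:] ^ i) 0 = (1::rat)" by simp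
  then show False using i by (simp add: poly_power power_0_left)
qed

text \<open>
  Numerator and denominator differ by a Frobenius twist, which the homomorphism does not see
  because it sends \<open>t\<^bsup>q^r-q^s\<^esup>\<close> to \<open>t\<^bsup>r-s\<^esup>\<close>.
\<close>

lemma has_limit_q_1_q_bracket:
  assumes i: "1 \<le> i"
  shows "has_limit_q_1 (q_bracket (t_pow (q_pow y - q_pow (y - int i)))) 1"
proof -
  let ?m = "\<lambda>y. 1 - Poly_Mapping.single (q_pow y - q_pow (y - int i)) 1 :: t_laurent"
  have "q_bracket (t_pow (q_pow y - q_pow (y - int i))) = Fract (?m (y + 1)) (?m y)"
    using i by (simp add: q_bracket_t_pow right_diff_distrib q_pow_mult algebra_simps)
  moreover have "q_to_1 (?m y) = 1 - t_var ^ i" for y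
    by (simp add: one_minus_gen)
  ultimately show ?thesis unfolding has_limit_q_1_def
    using t_var_power_neq_1[OF i] one_minus_gen(1)
    by (intro bexI[of _ "?m (y + 1)"] bexI[of _ "?m y"]) auto
qed

lemma has_limit_q_1_column_wt: "has_limit_q_1 (column_wt y c) (t_var ^ c)"
proof -
  have "has_limit_q_1 (\<Prod>i = 1..c. q_bracket (t_pow (q_pow y - q_pow (y - int i)))) (\<Prod>i = 1..c. 1)"
    by (intro has_limit_q_1_prod has_limit_q_1_q_bracket) auto
  from has_limit_q_1_mult[OF has_limit_q_1_t_pow this, of y "y - int c"]
  show ?thesis by (simp add: column_wt_eq_brackets)
qed

section \<open>The skew Schur analogue as a sum over tableaux\<close>

theorem theorem6p6:
  fixes lam mu :: "nat list" and k :: nat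
  assumes "skew_shape lam mu"
  shows "skew_schur k lam mu = (\<Sum>T \<in> tableaux k lam mu. tableau_wt k lam mu T) \<and>
    (\<forall>T \<in> tableaux k lam mu.
       (\<forall>q::nat. q \<ge> 2 \<longrightarrow>
          has_limit_t_1 q (tableau_wt k lam mu T) (of_nat q ^ entry_sum lam mu T)) \<and>
       has_limit_q_1 (tableau_wt k lam mu T) (t_var ^ entry_sum lam mu T))"
proof (intro conjI ballI allI impI)
  have shape: "length mu = length lam" "sorted_wrt (\<ge>) lam" "sorted_wrt (\<ge>) mu"
    "\<And>i. i < length lam \<Longrightarrow> mu ! i \<le> lam ! i"
    using assms by (auto simp: skew_shape_def)
  have flag: "flag (Suc k) 0 = (\<lambda>_. Suc k)" by (simp add: flag_def fun_eq_iff)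
  have "skew_schur k lam mu =
      (\<Sum>T \<in> tableaux k lam mu. content_wt (entry_wt k) (skew_cells lam mu) T)"
    unfolding skew_schur_eq_jt_det tableaux_eq_flagged_tableaux skew_cells_eq_cells flag[symmetric]
    by (rule jacobi_trudi_flag)
      (use shape in \<open>auto simp: sorted_wrt_iff_nth_less\<close>)
  then show "skew_schur k lam mu = (\<Sum>T \<in> tableaux k lam mu. tableau_wt k lam mu T)"
    by (simp add: tableau_wt_eq_content_wt)
next
  fix T q assume T: "T \<in> tableaux k lam mu" and q: "2 \<le> (q::nat)"
  have "has_limit_t_1 q (content_wt (entry_wt k) (skew_cells lam mu) T)
      (\<Prod>(i, j) \<in> skew_cells lam mu. of_nat q ^ T (i, j))"
    unfolding content_wt_def case_prod_unfold entry_wt_def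
    using q by (intro has_limit_t_1_prod) (simp add: has_limit_t_1_column_wt)
  then show "has_limit_t_1 q (tableau_wt k lam mu T) (of_nat q ^ entry_sum lam mu T)"
    by (simp add: tableau_wt_eq_content_wt T entry_sum_def power_sum case_prod_unfold)
next
  fix T assume T: "T \<in> tableaux k lam mu"
  have "has_limit_q_1 (content_wt (entry_wt k) (skew_cells lam mu) T)
      (\<Prod>(i, j) \<in> skew_cells lam mu. t_var ^ T (i, j))"
    unfolding content_wt_def case_prod_unfold entry_wt_def
    by (intro has_limit_q_1_prod) (simp add: has_limit_q_1_column_wt)
  then show "has_limit_q_1 (tableau_wt k lam mu T) (t_var ^ entry_sum lam mu T)"
    by (simp add: tableau_wt_eq_content_wt T entry_sum_def power_sum case_prod_unfold)
qed

end
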